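(* Let $\{a_k\}_{k\in\mathbb{Z}}$ be a probability distribution on $\mathbb{Z}$ with mean $0$, positive variance $\eta^2$ and finite $r$-th absolute moment for some $r>4$. Let $\{p_k\}_{k\ge 0}$ be a probability distribution on $\{0,1,2,\dots\}$ with mean $1$, positive (finite) variance $\sigma^2$ and finite third moment. Let $M$ be the maximal displacement of the branching random walk on $\mathbb{Z}$ with step distribution $\{a_k\}$ and offspring distribution $\{p_k\}$, started from a single particle at $0$. Then $$P\{M\ge x\}\sim \frac{6\eta^2}{\sigma^2x^2}\qquad\text{as } x\to\infty .$$
   Context: Branching random walk: at time $0$ there is one particle, at the origin. In each generation every particle first jumps, its displacement having law $\{a_k\}_{k\in\mathbb{Z}}$, and then at its new location is replaced by a random number of offspring with law $\{p_k\}_{k\ge0}$, all placed at that location; all jumps and offspring numbers are independent. $N_n$ is the number of particles in generation $n$ (after the reproduction step), $X_{n,1},\dots,X_{n,N_n}$ are their locations, $M_n=\max_{1\le i\le N_n}X_{n,i}$ (with $M_n=-\infty$ if $N_n=0$), and the maximal displacement is $M=\max_{n\ge0}M_n$. Here $f(x)\sim g(x)$ means $f(x)/g(x)\to1$. *)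

theory Defs
  imports "HOL-Probability.Probability" "HOL-Library.Landau_Symbols"
begin

text \<open>
  Particles carry Ulam-Harris labels: the initial particle is \<open>[]\<close> and the children of
  \<open>u\<close> are \<open>u @ [i]\<close>, \<open>i < nu u\<close>.  A realisation of the walk is given by the jumps
  \<open>xi u\<close> and the offspring numbers \<open>nu u\<close>, for all potential labels \<open>u\<close>.
\<close>

primrec generation :: "(nat list \<Rightarrow> nat) \<Rightarrow> nat \<Rightarrow> nat list set" where
  "generation nu 0 = {[]}"
| "generation nu (Suc n) = {u @ [i] | u i. u \<in> generation nu n \<and> i < nu u}"

text \<open>
  A particle jumps first and is then replaced by its offspring at its new location.  Hence a
  particle is located, right after the reproduction step in which it is born, at the sum of the
  jumps of its strict ancestors; siblings share the same location, and a particle's own jump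
  displaces only its descendants.
\<close>

definition location :: "(nat list \<Rightarrow> int) \<Rightarrow> nat list \<Rightarrow> int" where
  "location xi u = (\<Sum>k<length u. xi (take k u))"

definition generation_max :: "(nat list \<Rightarrow> int) \<Rightarrow> (nat list \<Rightarrow> nat) \<Rightarrow> nat \<Rightarrow> ereal" where
  "generation_max xi nu n =
     (if generation nu n = {} then - \<infinity>
      else ereal (real_of_int (Max (location xi ` generation nu n))))"

definition maximal_displacement :: "(nat list \<Rightarrow> int) \<Rightarrow> (nat list \<Rightarrow> nat) \<Rightarrow> ereal" where
  "maximal_displacement xi nu = (SUP n. generation_max xi nu n)"

text \<open>
  The pairs (jump, offspring number) are independent over the labels, and each of them has law
  \<open>pair_pmf a p\<close>; so all jumps have law \<open>a\<close>, all offspring numbers have law \<open>p\<close>, and all of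
  these variables together are independent.
\<close>

locale branching_random_walk = prob_space W
  for W :: "'w measure" and a :: "int pmf" and p :: "nat pmf"
    and xi :: "nat list \<Rightarrow> 'w \<Rightarrow> int" and nu :: "nat list \<Rightarrow> 'w \<Rightarrow> nat" +
  assumes indep: "indep_vars (\<lambda>_. count_space UNIV) (\<lambda>u \<omega>. (xi u \<omega>, nu u \<omega>)) UNIV"
    and law: "distr W (count_space UNIV) (\<lambda>\<omega>. (xi u \<omega>, nu u \<omega>)) = measure_pmf (pair_pmf a p)"

lemma finite_generation: "finite (generation nu n)"
proof (induction n)
  case (Suc n)
  have "generation nu (Suc n) = (\<Union>u\<in>generation nu n. (\<lambda>i. u @ [i]) ` {..<nu u})"
    by auto
  with Suc show ?case by simp
qed simp

lemma branching_random_walk_exists: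
  "branching_random_walk (PiM UNIV (\<lambda>_. measure_pmf (pair_pmf a p))) a p
     (\<lambda>u \<omega>. fst (\<omega> u)) (\<lambda>u \<omega>. snd (\<omega> u))"
proof -
  let ?m = "\<lambda>_::nat list. measure_pmf (pair_pmf a p)"
  interpret P: product_prob_space ?m UNIV
    by unfold_locales
  have ps: "prob_space (PiM UNIV ?m)"
    by (rule P.P.prob_space_axioms)
  have meas: "(\<lambda>\<omega>. \<omega> u) \<in> PiM UNIV ?m \<rightarrow>\<^sub>M count_space UNIV" for u
    using measurable_component_singleton[of u UNIV ?m] by (simp cong: measurable_cong_sets)
  have law: "distr (PiM UNIV ?m) (count_space UNIV) (\<lambda>\<omega>. \<omega> u) = measure_pmf (pair_pmf a p)" for u
  proof -
    have "distr (PiM UNIV ?m) (count_space UNIV) (\<lambda>\<omega>. \<omega> u) = distr (PiM UNIV ?m) (?m u) (\<lambda>\<omega>. \<omega> u)"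
      by (rule distr_cong) auto
    also have "\<dots> = ?m u" by (rule P.PiM_component) simp
    finally show ?thesis .
  qed
  have sets: "sets (PiM UNIV ?m) = sets (PiM UNIV (\<lambda>_::nat list. count_space (UNIV :: (int \<times> nat) set)))"
    by (rule sets_PiM_cong) auto
  have "distr (PiM UNIV ?m) (PiM UNIV (\<lambda>_. count_space UNIV)) (\<lambda>\<omega>. \<lambda>u\<in>UNIV. \<omega> u) = PiM UNIV ?m"
    using distr_id2[OF sets[symmetric]] by (simp add: restrict_UNIV)
  then have indep: "prob_space.indep_vars (PiM UNIV ?m) (\<lambda>_. count_space UNIV) (\<lambda>u \<omega>. \<omega> u) UNIV"
    using prob_space.indep_vars_iff_distr_eq_PiM[OF ps, of UNIV "\<lambda>u \<omega>. \<omega> u" "\<lambda>_. count_space UNIV"] meas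
    by (simp add: law)
  show ?thesis
    using ps indep law
    by (simp add: branching_random_walk_def branching_random_walk_axioms_def)
qed

end

theory Submission
  imports Defs "HOL-Real_Asymp.Real_Asymp"
begin

text \<open>
  Decomposing at the first jump and reproduction, \<open>u x = P(M \<ge> x)\<close> solves
  \<open>u x = E (Q (u (x - \<xi>)))\<close> for \<open>x > 0\<close> and \<open>u = 1\<close> on \<open>x \<le> 0\<close>, where \<open>\<xi>\<close> is a jump and
  \<open>Q s = 1 - E ((1 - s) ^ N) = s - \<sigma>\<^sup>2 / 2 * s\<^sup>2 + O(s ^ 3)\<close>.  Letting \<open>x\<close> tend to infinity, the
  limit of \<open>u\<close> is a fixed point of \<open>Q\<close>, hence \<open>0\<close>.  As \<open>Q\<close> is monotone and 1-Lipschitz, a comparison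
  principle holds for functions that vanish at infinity.  Since
  \<open>E (c / (z - \<xi>)\<^sup>2) = c / z\<^sup>2 + 3 * \<eta>\<^sup>2 * c / z ^ 4 + o(z ^ -4)\<close>, the function \<open>c / z\<^sup>2\<close> is a
  supersolution for large \<open>z\<close> if \<open>c > 6 * \<eta>\<^sup>2 / \<sigma>\<^sup>2\<close> and a subsolution if \<open>c < 6 * \<eta>\<^sup>2 / \<sigma>\<^sup>2\<close>;
  suitable translates of it bound \<open>u\<close> from above and below.
\<close>

section \<open>The first-step recursion\<close>

lemma mem_generation_iff:
  "v \<in> generation nu n \<longleftrightarrow> length v = n \<and> (\<forall>k<n. v ! k < nu (take k v))"
proof (induction n arbitrary: v)
  case (Suc n)
  show ?case
  proof (cases v rule: rev_cases)
    case (snoc w i)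
    have "v \<in> generation nu (Suc n) \<longleftrightarrow> w \<in> generation nu n \<and> i < nu w"
      using snoc by auto
    also have "\<dots> \<longleftrightarrow> length w = n \<and> (\<forall>k<n. w ! k < nu (take k w)) \<and> i < nu w"
      by (simp add: Suc)
    also have "\<dots> \<longleftrightarrow> length v = Suc n \<and> (\<forall>k<Suc n. v ! k < nu (take k v))"
      using snoc by (auto simp: nth_append less_Suc_eq)
    finally show ?thesis .
  qed auto
qed auto

text \<open>Existence of a label whose ancestral line is realised and whose location is at least
  \<open>x\<close>. Being phrased for the whole family \<open>X\<close> of pairs, it applies equally
  to the subtree family \<open>X (i # v)\<close>; having neither a maximum nor a supremum, it is a
  countable union over labels and so plainly measurable.\<close>

definition reaches :: "(nat list \<Rightarrow> int \<times> nat) \<Rightarrow> int \<Rightarrow> bool" where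
  "reaches X x \<longleftrightarrow> (\<exists>v. (\<forall>k<length v. v ! k < snd (X (take k v))) \<and>
     x \<le> (\<Sum>k<length v. fst (X (take k v))))"

lemma reaches_nonpos: "x \<le> 0 \<Longrightarrow> reaches X x"
  unfolding reaches_def by (rule exI[of _ "[]"]) simp

lemma reaches_mono: "x \<le> y \<Longrightarrow> reaches X y \<Longrightarrow> reaches X x"
  unfolding reaches_def by (meson order_trans)

text \<open>For \<open>x > 0\<close> the witness is not the root, which sits at 0, so it begins with
  a child \<open>i\<close>. All children share the root's jump, hence each subtree has to reach the
  same level \<open>x - fst (X [])\<close>.\<close>

lemma reaches_first_step:
  assumes "x > 0"
  shows "reaches X x \<longleftrightarrow> (\<exists>i<snd (X []). reaches (\<lambda>v. X (i # v)) (x - fst (X [])))"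
    (is "?L \<longleftrightarrow> ?R")
proof
  assume ?L
  then obtain v where v: "\<forall>k<length v. v ! k < snd (X (take k v))"
    "x \<le> (\<Sum>k<length v. fst (X (take k v)))" unfolding reaches_def by auto
  with \<open>x > 0\<close> obtain i w where iw: "v = i # w" by (cases v) auto
  have "i < snd (X [])" using v(1) iw by (auto dest: spec[of _ 0])
  moreover have "\<forall>k<length w. w ! k < snd (X (i # take k w))"
    using v(1) iw by (auto dest: spec[of _ "Suc _"])
  moreover have "x - fst (X []) \<le> (\<Sum>k<length w. fst (X (i # take k w)))"
    using v(2) iw by (simp add: sum.lessThan_Suc_shift del: sum.lessThan_Suc)
  ultimately show ?R unfolding reaches_def by blast
next
  assume ?R
  then obtain i w where i: "i < snd (X [])"
    and w: "\<forall>k<length w. w ! k < snd (X (i # take k w))"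
      "x - fst (X []) \<le> (\<Sum>k<length w. fst (X (i # take k w)))"
    unfolding reaches_def by auto
  have "\<forall>k<length (i # w). (i # w) ! k < snd (X (take k (i # w)))"
    using i w(1) by (auto simp: less_Suc_eq_0_disj)
  moreover have "x \<le> (\<Sum>k<length (i # w). fst (X (take k (i # w))))"
    using w(2) by (simp add: sum.lessThan_Suc_shift del: sum.lessThan_Suc)
  ultimately show ?L unfolding reaches_def by blast
qed

lemma generation_max_ge_iff:
  "ereal x \<le> generation_max xi nu n \<longleftrightarrow>
     (\<exists>v\<in>generation nu n. x \<le> real_of_int (location xi v))"
proof (cases "generation nu n = {}")
  case False
  let ?L = "location xi ` generation nu n"
  have "Max ?L \<in> ?L" "\<And>v. v \<in> generation nu n \<Longrightarrow> location xi v \<le> Max ?L"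
    using False finite_generation[of nu n] by (auto intro!: Max_in)
  then show ?thesis using False unfolding generation_max_def
    by (auto simp: image_iff) (meson of_int_le_iff order_trans)
qed (simp add: generation_max_def)

text \<open>A supremum may exceed a level that no term reaches up to; here locations are integers,
  so if every generation stays below \<open>x\<close>, all stay at or below \<lceil>x\<rceil> - 1,
  and so does the supremum.\<close>

lemma maximal_displacement_ge_iff:
  "maximal_displacement xi nu \<ge> ereal x \<longleftrightarrow> reaches (\<lambda>v. (xi v, nu v)) \<lceil>x\<rceil>"
proof -
  have reach: "reaches (\<lambda>v. (xi v, nu v)) \<lceil>x\<rceil> \<longleftrightarrow> (\<exists>n. ereal x \<le> generation_max xi nu n)"
    by (auto simp: reaches_def generation_max_ge_iff mem_generation_iff location_def Bex_def
        ceiling_le_iff simp flip: of_int_sum)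
  have "ereal x \<le> maximal_displacement xi nu \<Longrightarrow> \<exists>n. ereal x \<le> generation_max xi nu n"
  proof (rule ccontr)
    assume x: "ereal x \<le> maximal_displacement xi nu" and "\<nexists>n. ereal x \<le> generation_max xi nu n"
    then have less: "\<not> ereal x \<le> generation_max xi nu n" for n by blast
    have "generation_max xi nu n \<le> ereal (real_of_int (\<lceil>x\<rceil> - 1))" for n
    proof (rule ccontr)
      assume "\<not> generation_max xi nu n \<le> ereal (real_of_int (\<lceil>x\<rceil> - 1))"
      moreover then obtain m where m: "generation_max xi nu n = ereal (real_of_int m)"
        by (auto simp: generation_max_def split: if_splits)
      ultimately have "m > \<lceil>x\<rceil> - 1" by simp
      then have "x \<le> m" by linarith
      with less[of n] m show False by simp
    qed
    then have "maximal_displacement xi nu \<le> ereal (real_of_int (\<lceil>x\<rceil> - 1))"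
      unfolding maximal_displacement_def by (intro SUP_least) auto
    with x have "x \<le> real_of_int (\<lceil>x\<rceil> - 1)" by (metis ereal_less_eq(3) order_trans)
    then show False by linarith
  qed
  moreover have "ereal x \<le> generation_max xi nu n \<Longrightarrow> ereal x \<le> maximal_displacement xi nu" for n
    unfolding maximal_displacement_def by (meson SUP_upper UNIV_I order_trans)
  ultimately show ?thesis using reach by blast
qed

section \<open>Measurability, and independence of the subtrees\<close>

lemma measurable_reaches:
  "{X \<in> space (PiM UNIV (\<lambda>_. count_space UNIV)). reaches X x}
     \<in> sets (PiM UNIV (\<lambda>_. count_space UNIV))"
proof -
  let ?P = "PiM UNIV (\<lambda>_::nat list. count_space (UNIV :: (int \<times> nat) set))"
  have comp: "(\<lambda>X. X v) \<in> ?P \<rightarrow>\<^sub>M count_space UNIV" for v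
    by (rule measurable_component_singleton) simp
  have snd [measurable]: "Measurable.pred ?P (\<lambda>X. m < snd (X v))" for m v
    by (rule measurable_compose[OF comp]) simp
  have [measurable]: "(\<lambda>X. real_of_int (fst (X v))) \<in> borel_measurable ?P" for v
    by (rule measurable_compose[OF comp]) simp
  have "reaches X x \<longleftrightarrow> (\<exists>v. (\<forall>k\<in>{..<length v}. v ! k < snd (X (take k v))) \<and>
     real_of_int x \<le> (\<Sum>k<length v. real_of_int (fst (X (take k v)))))" for X
    unfolding reaches_def of_int_sum[symmetric] of_int_le_iff by auto
  then show ?thesis by simp
qed

text \<open>The function \<open>Q\<close>: some offspring succeeds, each independently with probability \<open>s\<close>.\<close>

definition some_child_prob :: "nat pmf \<Rightarrow> real \<Rightarrow> real" where
  "some_child_prob p s = measure_pmf.expectation p (\<lambda>j. 1 - (1 - s) ^ j)"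

text \<open>Taken on the canonical product space, the probability depends on \<open>a\<close> and
  \<open>p\<close> only, so one function serves the whole tree and every subtree.\<close>

definition reach_prob :: "int pmf \<Rightarrow> nat pmf \<Rightarrow> int \<Rightarrow> real" where
  "reach_prob a p x = measure (PiM UNIV (\<lambda>_::nat list. measure_pmf (pair_pmf a p)))
     {X \<in> space (PiM UNIV (\<lambda>_. count_space UNIV)). reaches X x}"

context branching_random_walk
begin

abbreviation X where "X v \<omega> \<equiv> (xi v \<omega>, nu v \<omega>)"

lemma meas_X [measurable]: "X v \<in> W \<rightarrow>\<^sub>M count_space UNIV"
  using indep unfolding indep_vars_def2 by auto

text \<open>An injective relabelling of an i.i.d. family is i.i.d. with the same marginals, hence
  has the same product law. It is used with \<open>g = id\<close> for the whole tree and with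
  \<open>g = (#) i\<close> for the subtree below child \<open>i\<close>.\<close>

lemma prob_reaches_inj:
  assumes "inj g"
  shows "prob {\<omega>\<in>space W. reaches (\<lambda>v. X (g v) \<omega>) x} = reach_prob a p x"
proof -
  let ?C = "\<lambda>_::nat list. count_space (UNIV :: (int \<times> nat) set)"
  have "indep_vars ?C (\<lambda>v. X (g v)) UNIV"
    unfolding indep_vars_def2
  proof (intro conjI ballI indep_setsI)
    fix A J assume J: "J \<noteq> {}" "finite J" "J \<subseteq> UNIV" "\<forall>j\<in>J. A j \<in> {X (g j) -` B \<inter> space W |B. B \<in> sets (?C j)}"
    then obtain B where B: "\<And>j. j \<in> J \<Longrightarrow> A j = X (g j) -` B j \<inter> space W" by (simp, metis)
    have "prob (\<Inter>i\<in>g ` J. X i -` B (inv g i) \<inter> space W) = (\<Prod>i\<in>g ` J. prob (X i -` B (inv g i) \<inter> space W))"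
      using J by (intro indep_varsD[OF indep]) auto
    then have "prob (\<Inter>i\<in>J. X (g i) -` B i \<inter> space W) = (\<Prod>i\<in>J. prob (X (g i) -` B i \<inter> space W))"
      using inv_f_f[OF assms] inj_on_subset[OF assms, of J] J
      by (simp add: prod.reindex)
    then show "prob (\<Inter> (A ` J)) = (\<Prod>j\<in>J. prob (A j))"
      using B by (simp cong: prod.cong)
  qed (auto intro: measurable_sets)
  then have "distr W (PiM UNIV ?C) (\<lambda>\<omega>. \<lambda>v\<in>UNIV. X (g v) \<omega>)
      = PiM UNIV (\<lambda>v. distr W (count_space UNIV) (X (g v)))"
    by (subst (asm) indep_vars_iff_distr_eq_PiM) auto
  then have d: "distr W (PiM UNIV ?C) (\<lambda>\<omega> v. X (g v) \<omega>)
      = PiM UNIV (\<lambda>_. measure_pmf (pair_pmf a p))"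
    by (simp add: law restrict_UNIV)
  have m: "(\<lambda>\<omega> v. X (g v) \<omega>) \<in> W \<rightarrow>\<^sub>M PiM UNIV ?C"
    by (rule measurable_PiM_single') auto
  show ?thesis unfolding reach_prob_def d[symmetric]
    by (subst measure_distr[OF m measurable_reaches])
      (auto intro!: arg_cong[where f=prob] simp: space_PiM)
qed

lemma events_reaches_inj:
  "{\<omega>\<in>space W. reaches (\<lambda>v. X (g v) \<omega>) x} \<in> events"
proof -
  have "(\<lambda>\<omega> v. X (g v) \<omega>) \<in> W \<rightarrow>\<^sub>M PiM UNIV (\<lambda>_. count_space UNIV)"
    by (rule measurable_PiM_single') auto
  from measurable_sets[OF this measurable_reaches[of x]] show ?thesis
    by (simp add: space_PiM vimage_def Int_def conj_commute)
qed

text \<open>The root's pair and the families below the children \<open>i < j\<close> involve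
  disjoint sets of labels, so they are independent. Each subtree misses level \<open>y\<close> with
  probability \<open>1 - reach_prob a p y\<close>.\<close>

lemma prob_root_no_child_reaches:
  "prob {\<omega>\<in>space W. X [] \<omega> = (k, j) \<and> (\<forall>i<j. \<not> reaches (\<lambda>v. X (i # v) \<omega>) y)}
     = pmf (pair_pmf a p) (k, j) * (1 - reach_prob a p y) ^ j"
proof -
  let ?C = "\<lambda>_::nat list. count_space (UNIV :: (int \<times> nat) set)"
  \<comment> \<open>The blocks of labels: \<open>None\<close> stands for the root,
    \<open>Some i\<close> for all labels starting with \<open>i\<close>.\<close>
  define K where "K l = (case l of None \<Rightarrow> {[]} | Some i \<Rightarrow> range ((#) i))" for l :: "nat option"
  define L where "L = insert None (Some ` {..<j})"
  define A where "A l = {Y \<in> space (PiM (K l) ?C). case l of None \<Rightarrow> Y [] = (k, j)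
     | Some i \<Rightarrow> \<not> reaches (\<lambda>v. Y (i # v)) y}" for l
  have "indep_vars (\<lambda>l. PiM (K l) ?C) (\<lambda>l \<omega>. restrict (\<lambda>v. X v \<omega>) (K l)) L"
    by (intro indep_vars_restrict[OF indep])
      (auto simp: disjoint_family_on_def K_def split: option.splits)
  moreover have "A l \<in> sets (PiM (K l) ?C)" for l
  proof (cases l)
    case None
    have "(\<lambda>Y. Y []) \<in> PiM {[]} ?C \<rightarrow>\<^sub>M count_space UNIV"
      by (rule measurable_component_singleton) simp
    from measurable_sets[OF this, of "{(k, j)}"] show ?thesis
      using None by (simp add: A_def K_def vimage_def Int_def conj_commute)
  next
    case (Some i)
    have "(\<lambda>Y v. Y (i # v)) \<in> PiM (range ((#) i)) ?C \<rightarrow>\<^sub>M PiM UNIV ?C"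
      by (rule measurable_PiM_single') (auto simp: space_PiM)
    from measurable_sets[OF this measurable_reaches[of y]]
    have "{Y \<in> space (PiM (K l) ?C). reaches (\<lambda>v. Y (i # v)) y} \<in> sets (PiM (K l) ?C)"
      using Some by (simp add: K_def space_PiM vimage_def Int_def conj_commute)
    then have "space (PiM (K l) ?C) - {Y \<in> space (PiM (K l) ?C). reaches (\<lambda>v. Y (i # v)) y}
        \<in> sets (PiM (K l) ?C)" by blast
    also have "space (PiM (K l) ?C) - {Y \<in> space (PiM (K l) ?C). reaches (\<lambda>v. Y (i # v)) y} = A l"
      using Some by (auto simp: A_def)
    finally show ?thesis .
  qed
  ultimately have "prob (\<Inter>l\<in>L. (\<lambda>\<omega>. restrict (\<lambda>v. X v \<omega>) (K l)) -` A l \<inter> space W)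
      = (\<Prod>l\<in>L. prob ((\<lambda>\<omega>. restrict (\<lambda>v. X v \<omega>) (K l)) -` A l \<inter> space W))"
    by (intro indep_varsD) (auto simp: L_def)
  moreover have "prob ((\<lambda>\<omega>. restrict (\<lambda>v. X v \<omega>) (K None)) -` A None \<inter> space W)
      = pmf (pair_pmf a p) (k, j)"
  proof -
    have "(\<lambda>\<omega>. restrict (\<lambda>v. X v \<omega>) (K None)) -` A None \<inter> space W = X [] -` {(k, j)} \<inter> space W"
      by (auto simp: A_def K_def space_PiM)
    then show ?thesis
      using measure_distr[OF meas_X[of "[]"], of "{(k, j)}"] by (simp add: law pmf.rep_eq)
  qed
  moreover have "prob ((\<lambda>\<omega>. restrict (\<lambda>v. X v \<omega>) (K (Some i))) -` A (Some i) \<inter> space W)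
      = 1 - reach_prob a p y" for i
  proof -
    have "(\<lambda>\<omega>. restrict (\<lambda>v. X v \<omega>) (K (Some i))) -` A (Some i) \<inter> space W
        = space W - {\<omega>\<in>space W. reaches (\<lambda>v. X (i # v) \<omega>) y}"
      by (auto simp: A_def K_def space_PiM)
    then show ?thesis
      using prob_compl[OF events_reaches_inj[of "(#) i" y]] prob_reaches_inj[of "(#) i" y] by simp
  qed
  moreover have "(\<Inter>l\<in>L. (\<lambda>\<omega>. restrict (\<lambda>v. X v \<omega>) (K l)) -` A l \<inter> space W)
      = {\<omega>\<in>space W. X [] \<omega> = (k, j) \<and> (\<forall>i<j. \<not> reaches (\<lambda>v. X (i # v) \<omega>) y)}"
    by (auto simp: L_def A_def K_def space_PiM)
  moreover have "(\<Prod>l\<in>L. f l) = f None * (\<Prod>i<j. f (Some i))" for f :: "nat option \<Rightarrow> real"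
    unfolding L_def by (subst prod.insert) (auto simp: prod.reindex)
  ultimately show ?thesis by simp
qed

lemma reach_prob_range: "0 \<le> reach_prob a p x" "reach_prob a p x \<le> 1"
  using prob_reaches_inj[of id x] by (auto simp: measure_nonneg simp flip: prob_reaches_inj[of id x])

lemma reach_prob_nonpos: "x \<le> 0 \<Longrightarrow> reach_prob a p x = 1"
  using prob_reaches_inj[of id x] by (simp add: reaches_nonpos prob_space)

lemma reach_prob_antimono: "x \<le> y \<Longrightarrow> reach_prob a p y \<le> reach_prob a p x"
  unfolding prob_reaches_inj[OF inj_on_id, symmetric]
  by (intro finite_measure_mono events_reaches_inj) (auto intro: reaches_mono)

text \<open>The complementary event splits disjointly according to the value
  \<open>z = (k, j)\<close> of the root's pair. Summing over the countably many \<open>z\<close>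
  gives an integral over \<open>pair_pmf a p\<close>, which is then iterated.\<close>

lemma reach_prob_recursion:
  assumes "x > 0"
  shows "reach_prob a p x = measure_pmf.expectation a (\<lambda>k. some_child_prob p (reach_prob a p (x - k)))"
proof -
  define E where "E z = {\<omega>\<in>space W. X [] \<omega> = z \<and>
    (\<forall>i<snd z. \<not> reaches (\<lambda>v. X (i # v) \<omega>) (x - fst z))}" for z
  have E_prob: "prob (E z) = pmf (pair_pmf a p) z * (1 - reach_prob a p (x - fst z)) ^ snd z" for z
    unfolding E_def using prob_root_no_child_reaches[of "fst z" "snd z" "x - fst z"] by simp
  have q: "0 \<le> 1 - reach_prob a p y" "1 - reach_prob a p y \<le> 1" for y using reach_prob_range[of y] by auto
  have E_events: "E z \<in> events" for z
  proof -
    have "E z = X [] -` {z} \<inter> space W \<inter>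
        (space W - (\<Union>i<snd z. {\<omega>\<in>space W. reaches (\<lambda>v. X (i # v) \<omega>) (x - fst z)}))"
      by (auto simp: E_def)
    also have "\<dots> \<in> events"
    proof (rule sets.Int)
      show "X [] -` {z} \<inter> space W \<in> events"
        by (rule measurable_sets[OF meas_X]) simp
    qed (auto intro!: sets.Diff sets.finite_UN events_reaches_inj)
    finally show ?thesis .
  qed
  have "space W - {\<omega>\<in>space W. reaches (\<lambda>v. X v \<omega>) x} = (\<Union>z. E z)"
    using reaches_first_step[OF assms] by (auto simp: E_def)
  \<comment> \<open>The summation is done in \<open>ennreal\<close>, where no integrability is at
    stake; the bounds 0 and 1 allow the return to reals at the end.\<close>
  then have "ennreal (1 - reach_prob a p x) = emeasure W (\<Union>z. E z)"
    using prob_compl[OF events_reaches_inj[of id x]] prob_reaches_inj[of id x]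
    by (simp add: emeasure_eq_measure)
  also have "\<dots> = (\<integral>\<^sup>+z. emeasure W (E z) \<partial>count_space UNIV)"
    by (rule emeasure_UN_countable) (auto simp: E_events disjoint_family_on_def, auto simp: E_def)
  also have "\<dots> = (\<integral>\<^sup>+z. ennreal ((1 - reach_prob a p (x - fst z)) ^ snd z) \<partial>measure_pmf (pair_pmf a p))"
    unfolding nn_integral_measure_pmf using q
    by (intro nn_integral_cong) (simp add: emeasure_eq_measure E_prob ennreal_mult)
  also have "\<dots> = (\<integral>\<^sup>+k. \<integral>\<^sup>+j. ennreal ((1 - reach_prob a p (x - k)) ^ j) \<partial>measure_pmf p \<partial>measure_pmf a)"
    unfolding nn_integral_pair_pmf' by simp
  also have "\<dots> = (\<integral>\<^sup>+k. ennreal (measure_pmf.expectation p (\<lambda>j. (1 - reach_prob a p (x - k)) ^ j)) \<partial>measure_pmf a)"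
    using q by (intro nn_integral_cong nn_integral_eq_integral measure_pmf.integrable_const_bound[where B=1])
      (auto simp: power_le_one)
  also have "\<dots> = ennreal (measure_pmf.expectation a (\<lambda>k. measure_pmf.expectation p (\<lambda>j. (1 - reach_prob a p (x - k)) ^ j)))"
    using q by (intro nn_integral_eq_integral measure_pmf.integrable_const_bound[where B=1])
      (auto simp: power_le_one intro!: measure_pmf.integral_le_const measure_pmf.integrable_const_bound[where B=1])
  also have "(\<lambda>k. measure_pmf.expectation p (\<lambda>j. (1 - reach_prob a p (x - k)) ^ j)) = (\<lambda>k. 1 - some_child_prob p (reach_prob a p (x - k)))"
  proof
    fix k
    have "integrable (measure_pmf p) (\<lambda>j. (1 - reach_prob a p (x - k)) ^ j)"
      using q by (intro measure_pmf.integrable_const_bound[where B=1]) (auto simp: power_le_one)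
    then show "measure_pmf.expectation p (\<lambda>j. (1 - reach_prob a p (x - k)) ^ j) = 1 - some_child_prob p (reach_prob a p (x - k))"
      by (simp add: some_child_prob_def)
  qed
  finally have "ennreal (1 - reach_prob a p x) = ennreal (measure_pmf.expectation a (\<lambda>k. 1 - some_child_prob p (reach_prob a p (x - k))))" .
  moreover have h: "0 \<le> some_child_prob p (reach_prob a p y)" "some_child_prob p (reach_prob a p y) \<le> 1" for y
  proof -
    have i: "integrable (measure_pmf p) (\<lambda>j. 1 - (1 - reach_prob a p y) ^ j)"
      using q by (intro measure_pmf.integrable_const_bound[where B=1]) (auto simp: power_le_one)
    show "0 \<le> some_child_prob p (reach_prob a p y)" "some_child_prob p (reach_prob a p y) \<le> 1" unfolding some_child_prob_def
      using q i by (auto simp: power_le_one intro!: measure_pmf.integral_le_const integral_nonneg_AE)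
  qed
  moreover have "integrable (measure_pmf a) (\<lambda>k. some_child_prob p (reach_prob a p (x - k)))"
    using h by (intro measure_pmf.integrable_const_bound[where B=1]) auto
  moreover then have "0 \<le> measure_pmf.expectation a (\<lambda>k. 1 - some_child_prob p (reach_prob a p (x - k)))"
    using h by (intro integral_nonneg_AE) auto
  ultimately show ?thesis using q by simp
qed

end

section \<open>Elementary inequalities\<close>

lemma power_one_minus_diff_le:
  fixes s t :: real
  assumes "0 \<le> s" "s \<le> t" "t \<le> 1"
  shows "(1 - s) ^ j - (1 - t) ^ j \<le> real j * (t - s)"
proof (induction j)
  case (Suc j)
  have "(1 - s) ^ Suc j - (1 - t) ^ Suc j
    = (1 - s) ^ j * (t - s) + (1 - t) * ((1 - s) ^ j - (1 - t) ^ j)" by (simp add: algebra_simps)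
  also have "\<dots> \<le> 1 * (t - s) + 1 * ((1 - s) ^ j - (1 - t) ^ j)"
  proof (intro add_mono mult_right_mono)
    show "(1 - s) ^ j \<le> 1" using assms by (simp add: power_le_one)
    show "0 \<le> (1 - s) ^ j - (1 - t) ^ j" using power_mono[of "1 - t" "1 - s" j] assms by linarith
  qed (use assms in simp_all)
  also have "\<dots> \<le> real (Suc j) * (t - s)" using Suc by (simp add: algebra_simps)
  finally show ?case .
qed simp

lemma power_one_minus_le:
  fixes t :: real
  assumes "0 \<le> t" "t \<le> 1"
  shows "(1 - t) ^ j \<le> 1 - real j * t + real j * (real j - 1) / 2 * t\<^sup>2"
proof (induction j)
  case (Suc j)
  have 0: "0 \<le> real j * (real j - 1)" by (cases j) auto
  have "(1 - t) ^ Suc j \<le> (1 - t) * (1 - real j * t + real j * (real j - 1) / 2 * t\<^sup>2)"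
    using Suc assms by (simp add: mult_left_mono)
  also have "\<dots> = 1 - real (Suc j) * t + real (Suc j) * (real (Suc j) - 1) / 2 * t\<^sup>2
      - real j * (real j - 1) / 2 * t ^ 3"
    by (simp add: field_simps power2_eq_square power3_eq_cube)
  also have "\<dots> \<le> 1 - real (Suc j) * t + real (Suc j) * (real (Suc j) - 1) / 2 * t\<^sup>2"
    using 0 assms by simp
  finally show ?case .
qed simp

text \<open>The crude cubic coefficient j^3 keeps the induction simple, and its expectation is
  finite by the third-moment assumption.\<close>

lemma power_one_minus_ge:
  fixes t :: real
  assumes "0 \<le> t" "t \<le> 1"
  shows "1 - real j * t + real j * (real j - 1) / 2 * t\<^sup>2 - real j ^ 3 * t ^ 3 \<le> (1 - t) ^ j"
proof (induction j)
  case (Suc j)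
  have "1 - real (Suc j) * t + real (Suc j) * (real (Suc j) - 1) / 2 * t\<^sup>2 - real (Suc j) ^ 3 * t ^ 3
     \<le> (1 - t) * (1 - real j * t + real j * (real j - 1) / 2 * t\<^sup>2 - real j ^ 3 * t ^ 3)"
  proof -
    have "(1 - t) * (1 - real j * t + real j * (real j - 1) / 2 * t\<^sup>2 - real j ^ 3 * t ^ 3)
       - (1 - real (Suc j) * t + real (Suc j) * (real (Suc j) - 1) / 2 * t\<^sup>2 - real (Suc j) ^ 3 * t ^ 3)
       = t ^ 3 * ((1 + 3 * real j + 3 * (real j)\<^sup>2) - real j * (real j - 1) / 2 + real j ^ 3 * t)"
      by (simp add: field_simps power2_eq_square power3_eq_cube)
    moreover have "0 \<le> (1 + 3 * real j + 3 * (real j)\<^sup>2) - real j * (real j - 1) / 2 + real j ^ 3 * t"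
      using assms by (simp add: field_simps power2_eq_square)
    ultimately show ?thesis using assms by (smt (verit) mult_nonneg_nonneg zero_le_power)
  qed
  also have "\<dots> \<le> (1 - t) ^ Suc j" using Suc assms by (simp add: mult_left_mono)
  finally show ?case .
qed simp

text \<open>Second-order Taylor bound on a half-line, so that it covers arbitrarily large negative
  jumps. The polynomial part times (1 - h)^2 equals 1 - 4 h^3 + 3 h^4; for 0 \<le> h \<le> 1/2 the
  constant 16 compensates the loss 4 h^3, because (1 - h)^2 \<ge> 1/4.\<close>

lemma inverse_square_upper:
  fixes h :: real
  assumes "h \<le> 1 / 2"
  shows "1 / (1 - h)\<^sup>2 \<le> 1 + 2 * h + 3 * h\<^sup>2 + 16 * \<bar>h\<bar> ^ 3"
proof -
  have pos: "(1 - h)\<^sup>2 > 0" using assms by simp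
  have "1 \<le> (1 + 2 * h + 3 * h\<^sup>2 + 16 * \<bar>h\<bar> ^ 3) * (1 - h)\<^sup>2"
  proof (cases "h \<ge> 0")
    case True
    have "(1 + 2 * h + 3 * h\<^sup>2 + 16 * \<bar>h\<bar> ^ 3) * (1 - h)\<^sup>2 - 1
       = 4 * h ^ 3 * (4 * (1 - h)\<^sup>2 - 1) + 3 * h ^ 4"
      using True by (simp add: algebra_simps power2_eq_square power3_eq_cube power4_eq_xxxx)
    moreover have "4 * (1 - h)\<^sup>2 \<ge> 1"
      using power_mono[of "1/2" "1 - h" 2] assms by (simp add: power2_eq_square)
    ultimately show ?thesis using True by (smt (verit) mult_nonneg_nonneg zero_le_power)
  next
    case False
    have "(1 + 2 * h + 3 * h\<^sup>2 + 16 * \<bar>h\<bar> ^ 3) * (1 - h)\<^sup>2 - 1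
       = 4 * \<bar>h\<bar> ^ 3 + 3 * h ^ 4 + 16 * \<bar>h\<bar> ^ 3 * (1 - h)\<^sup>2"
      using False by (simp add: algebra_simps power2_eq_square power3_eq_cube power4_eq_xxxx)
    moreover have "0 \<le> 4 * \<bar>h\<bar> ^ 3 + 3 * h ^ 4 + 16 * \<bar>h\<bar> ^ 3 * (1 - h)\<^sup>2"
      by (intro add_nonneg_nonneg mult_nonneg_nonneg) auto
    ultimately show ?thesis by linarith
  qed
  with pos show ?thesis by (simp add: pos_divide_le_eq)
qed

text \<open>The Taylor polynomial of degree 3 has product 1 - h^4 (5 - 4 h) with (1 - h)^2, so it is
  a lower bound here. The constant 22 leaves ample room and is dictated by the case h \<ge> 1/2 of
  \<open>inverse_square_lower_big\<close>.\<close>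

lemma inverse_square_lower:
  fixes h :: real
  assumes "h < 1 / 2"
  shows "1 + 2 * h + 3 * h\<^sup>2 - 22 * \<bar>h\<bar> ^ 3 \<le> 1 / (1 - h)\<^sup>2"
proof -
  have pos: "(1 - h)\<^sup>2 > 0" using assms by simp
  have "(1 + 2 * h + 3 * h\<^sup>2 - 22 * \<bar>h\<bar> ^ 3) * (1 - h)\<^sup>2
     \<le> (1 + 2 * h + 3 * h\<^sup>2 + 4 * h ^ 3) * (1 - h)\<^sup>2"
  proof -
    have "\<bar>h ^ 3\<bar> = \<bar>h\<bar> ^ 3" by (simp add: power_abs)
    moreover have "0 \<le> \<bar>h\<bar> ^ 3" by simp
    ultimately have "- 22 * \<bar>h\<bar> ^ 3 \<le> 4 * h ^ 3" by linarith
    then show ?thesis by (intro mult_right_mono) auto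
  qed
  also have "\<dots> = 1 - h ^ 4 * (5 - 4 * h)"
    by (simp add: algebra_simps power2_eq_square power3_eq_cube power4_eq_xxxx)
  also have "\<dots> \<le> 1" using assms by simp
  finally show ?thesis using pos by (simp add: pos_le_divide_eq)
qed

text \<open>For h \<ge> 1/2 one has 1 \<le> 8 h^3, 2 h \<le> 8 h^3 and 3 h^2 \<le> 6 h^3, which add
  up to 22 h^3. Thus the lower Taylor bound is nonpositive for large jumps.\<close>

lemma inverse_square_lower_big:
  fixes h :: real
  assumes "h \<ge> 1 / 2"
  shows "1 + 2 * h + 3 * h\<^sup>2 - 22 * \<bar>h\<bar> ^ 3 \<le> 0"
proof -
  have "1 \<le> 2 * h" using assms by simp
  then have "(2 * h) ^ m \<le> (2 * h) ^ 3" if "m \<le> 3" for m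
    using that by (rule power_increasing[rotated])
  from this[of 0] this[of 1] this[of 2]
  have "1 \<le> (2 * h) ^ 3" "2 * h \<le> (2 * h) ^ 3" "(2 * h)\<^sup>2 \<le> (2 * h) ^ 3" by simp_all
  moreover have "(2 * h) ^ 3 = 8 * h ^ 3" "(2 * h)\<^sup>2 = 4 * h\<^sup>2" by (simp_all add: power_mult_distrib)
  moreover have "\<bar>h\<bar> ^ 3 = h ^ 3" using assms by simp
  ultimately show ?thesis by linarith
qed

lemma inverse_fourth_power_lower:
  fixes h :: real
  assumes "h \<le> 1 / 2"
  shows "1 - 4 * \<bar>h\<bar> \<le> (1 / (1 - h)\<^sup>2)\<^sup>2"
proof (cases "h \<ge> 0")
  case True
  then have "(1 - h)\<^sup>2 \<le> 1" "(1 - h)\<^sup>2 > 0" using assms by (auto simp: power_le_one)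
  then have "1 \<le> 1 / (1 - h)\<^sup>2" by simp
  then have "1 \<le> (1 / (1 - h)\<^sup>2)\<^sup>2" by (rule one_le_power)
  then show ?thesis using True by simp
next
  case False
  \<comment> \<open>For h < 0, Bernoulli's inequality for q^4 together with q \<ge> 1 + h gives the
    slope 4.\<close>
  define q where "q = 1 / (1 - h)"
  have q: "0 \<le> q" "q \<le> 1" using False by (auto simp: q_def)
  have "q - (1 + h) = h\<^sup>2 / (1 - h)" using False by (simp add: q_def field_simps power2_eq_square)
  then have "q \<ge> 1 + h" using False by (smt (verit) divide_nonneg_pos zero_le_power2)
  have "1 - 4 * \<bar>h\<bar> \<le> 1 + real 4 * (q - 1)" using \<open>q \<ge> 1 + h\<close> False by simp
  also have "\<dots> \<le> q ^ 4" using Bernoulli_inequality[of "q - 1" 4] q by simp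
  also have "q ^ 4 = (1 / (1 - h)\<^sup>2)\<^sup>2" by (simp add: q_def power_divide flip: power_mult)
  finally show ?thesis .
qed

lemma inverse_fourth_power_upper:
  fixes h :: real
  assumes "h < 1 / 2"
  shows "(1 / (1 - h)\<^sup>2)\<^sup>2 \<le> 1 + 30 * \<bar>h\<bar>"
proof (cases "h \<ge> 0")
  case True
  define q where "q = 1 / (1 - h)"
  have q: "1 \<le> q" "q \<le> 2" using True assms by (auto simp: q_def field_simps)
  have "q - 1 = q * h" using assms by (simp add: q_def field_simps)
  then have "q - 1 \<le> 2 * h" using mult_right_mono[OF q(2) True] by simp
  have "q\<^sup>2 \<le> 4" "q ^ 3 \<le> 8" using q power_mono[of q 2 2] power_mono[of q 2 3] by auto
  then have "q ^ 3 + q\<^sup>2 + q + 1 \<le> 15" using q by linarith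
  \<comment> \<open>The constant 30 is 15 * 2: the cubic factor is at most 8 + 4 + 2 + 1 for q \<le>
    2, and q - 1 = q h \<le> 2 h.\<close>
  have "q ^ 4 - 1 = (q ^ 3 + q\<^sup>2 + q + 1) * (q - 1)"
    by (simp add: algebra_simps power2_eq_square power3_eq_cube power4_eq_xxxx)
  also have "\<dots> \<le> 15 * (2 * h)"
    using q \<open>q - 1 \<le> 2 * h\<close> \<open>q ^ 3 + q\<^sup>2 + q + 1 \<le> 15\<close> by (intro mult_mono) auto
  finally have "q ^ 4 \<le> 1 + 30 * \<bar>h\<bar>" using True by simp
  also have "q ^ 4 = (1 / (1 - h)\<^sup>2)\<^sup>2" by (simp add: q_def power_divide flip: power_mult)
  finally show ?thesis .
next
  case False
  then have "1 \<le> (1 - h)\<^sup>2" using power_mono[of 1 "1 - h" 2] by simp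
  then have "1 / (1 - h)\<^sup>2 \<le> 1" by (subst divide_le_eq_1_pos) auto
  then have "(1 / (1 - h)\<^sup>2)\<^sup>2 \<le> 1" by (simp add: power_le_one)
  then show ?thesis by simp
qed

lemma inverse_square_rescale:
  fixes z k :: real
  assumes "z > 0" "k < z"
  shows "c / (z - k)\<^sup>2 = c / z\<^sup>2 * (1 / (1 - k / z)\<^sup>2)"
proof -
  have "z - k = z * (1 - k / z)" using assms by (simp add: field_simps)
  then show ?thesis by (simp add: power_mult_distrib)
qed

lemma eventually_small_profile:
  fixes c :: real
  shows "\<forall>\<^sub>F z in at_top. c / (z / 2)\<^sup>2 \<le> 1"
proof -
  have "((\<lambda>z::real. c / (z / 2)\<^sup>2) \<longlongrightarrow> 0) at_top" by real_asymp
  then have "\<forall>\<^sub>F z in at_top. c / (z / 2)\<^sup>2 < 1" by (rule order_tendstoD) simp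
  then show ?thesis by eventually_elim simp
qed

section \<open>Comparison principle and decay\<close>

locale critical_walk =
  fixes a :: "int pmf" and p :: "nat pmf" and r \<eta> \<sigma> :: real
  assumes a_moment: "r > 4" "integrable (measure_pmf a) (\<lambda>k. \<bar>real_of_int k\<bar> powr r)"
    and a_mean: "measure_pmf.expectation a real_of_int = 0"
    and a_var: "measure_pmf.variance a real_of_int = \<eta>\<^sup>2" "\<eta>\<^sup>2 > 0"
    and p_moment: "integrable (measure_pmf p) (\<lambda>k. real k ^ 3)"
    and p_mean: "measure_pmf.expectation p real = 1"
    and p_var: "measure_pmf.variance p real = \<sigma>\<^sup>2" "\<sigma>\<^sup>2 > 0"
begin

section \<open>Moments of the offspring and step laws\<close>

lemma integrable_offspring:
  "integrable (measure_pmf p) real" "integrable (measure_pmf p) (\<lambda>j. (real j)\<^sup>2)"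
proof -
  have *: "real j ^ m \<le> real j ^ 3" if "m \<in> {1, 2}" for m j :: nat
    using that by (cases "j = 0") (auto intro!: power_increasing)
  show "integrable (measure_pmf p) real"
    using *[of 1] by (intro Bochner_Integration.integrable_bound[OF p_moment]) auto
  show "integrable (measure_pmf p) (\<lambda>j. (real j)\<^sup>2)"
    using *[of 2] by (intro Bochner_Integration.integrable_bound[OF p_moment]) auto
qed

lemma integrable_step:
  "m \<le> 4 \<Longrightarrow> integrable (measure_pmf a) (\<lambda>k. \<bar>real_of_int k\<bar> ^ m)"
proof -
  assume m: "m \<le> 4"
  have "\<bar>real_of_int k\<bar> ^ m \<le> 1 + \<bar>real_of_int k\<bar> powr r" for k
  proof (cases "k = 0")
    case False
    then have "\<bar>real_of_int k\<bar> ^ m = \<bar>real_of_int k\<bar> powr real m" by (simp add: powr_realpow)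
    also have "\<dots> \<le> \<bar>real_of_int k\<bar> powr r" using False m a_moment(1) by (intro powr_mono) auto
    finally show ?thesis by simp
  qed (auto simp: power_0_left)
  then have "norm (\<bar>real_of_int k\<bar> ^ m) \<le> norm (1 + \<bar>real_of_int k\<bar> powr r)" for k
    by (simp add: abs_of_nonneg add_nonneg_nonneg)
  moreover have "integrable (measure_pmf a) (\<lambda>k. 1 + \<bar>real_of_int k\<bar> powr r)"
    using a_moment(2) by simp
  ultimately show ?thesis
    by (auto intro: Bochner_Integration.integrable_bound)
qed

lemma integrable_step_low_order:
  "integrable (measure_pmf a) real_of_int" "integrable (measure_pmf a) (\<lambda>k. (real_of_int k)\<^sup>2)"
  "integrable (measure_pmf a) (\<lambda>k. \<bar>real_of_int k\<bar>)"
proof -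
  show "integrable (measure_pmf a) (\<lambda>k. \<bar>real_of_int k\<bar>)"
    using integrable_step[of 1] by simp
  then show "integrable (measure_pmf a) real_of_int"
    by (rule integrable_abs_cancel) simp
  show "integrable (measure_pmf a) (\<lambda>k. (real_of_int k)\<^sup>2)"
    using integrable_step[of 2] by simp
qed

lemma step_second_moment: "measure_pmf.expectation a (\<lambda>k. (real_of_int k)\<^sup>2) = \<eta>\<^sup>2"
  using a_var(1) a_mean by simp

lemma offspring_second_factorial_moment:
  "measure_pmf.expectation p (\<lambda>j. real j * (real j - 1)) = \<sigma>\<^sup>2"
  using measure_pmf.variance_eq[of p real] integrable_offspring p_var(1) p_mean
  by (simp add: algebra_simps power2_eq_square)

section \<open>Regularity, expansion and fixed points of Q\<close>

lemma integrable_some_child_prob: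
  fixes s :: real
  shows "0 \<le> s \<Longrightarrow> s \<le> 1 \<Longrightarrow> integrable (measure_pmf p) (\<lambda>j. 1 - (1 - s) ^ j)"
  by (intro measure_pmf.integrable_const_bound[where B=1]) (auto simp: power_le_one)

lemma some_child_prob_mono: "0 \<le> s \<Longrightarrow> s \<le> t \<Longrightarrow> t \<le> 1 \<Longrightarrow> some_child_prob p s \<le> some_child_prob p t"
  unfolding some_child_prob_def by (intro integral_mono integrable_some_child_prob) (auto intro: power_mono)

lemma some_child_prob_range: "0 \<le> s \<Longrightarrow> s \<le> 1 \<Longrightarrow> 0 \<le> some_child_prob p s \<and> some_child_prob p s \<le> 1"
  unfolding some_child_prob_def
  by (auto simp: power_le_one intro!: measure_pmf.integral_le_const integral_nonneg_AE integrable_some_child_prob)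

text \<open>The j-th term has Lipschitz constant j, and averaging over the offspring law gives the
  mean, which is 1 by criticality.\<close>

lemma some_child_prob_lipschitz:
  assumes "0 \<le> s" "s \<le> t" "t \<le> 1"
  shows "some_child_prob p t - some_child_prob p s \<le> t - s"
proof -
  have i: "integrable (measure_pmf p) (\<lambda>j. 1 - (1 - t) ^ j)" "integrable (measure_pmf p) (\<lambda>j. 1 - (1 - s) ^ j)"
    using assms integrable_some_child_prob[of t] integrable_some_child_prob[of s] by linarith+
  have "some_child_prob p t - some_child_prob p s = measure_pmf.expectation p (\<lambda>j. (1 - (1 - t) ^ j) - (1 - (1 - s) ^ j))"
    unfolding some_child_prob_def Bochner_Integration.integral_diff[OF i] ..
  also have "\<dots> \<le> measure_pmf.expectation p (\<lambda>j. real j * (t - s))"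
  proof (rule integral_mono)
    show "integrable (measure_pmf p) (\<lambda>j. real j * (t - s))"
      using integrable_offspring(1) by (rule integrable_mult_left)
    show "(1 - (1 - t) ^ j) - (1 - (1 - s) ^ j) \<le> real j * (t - s)" for j
      using power_one_minus_diff_le[OF assms] by simp
  qed (rule Bochner_Integration.integrable_diff[OF i])
  also have "\<dots> = t - s" using p_mean by simp
  finally show ?thesis .
qed

lemma some_child_prob_lipschitz_pos:
  assumes "0 \<le> s" "s \<le> 1" "0 \<le> t" "t \<le> 1"
  shows "some_child_prob p t - some_child_prob p s \<le> max 0 (t - s)"
  using some_child_prob_lipschitz[of s t] some_child_prob_mono[of t s] assms by linarith

lemma some_child_prob_ge:
  assumes "0 \<le> t" "t \<le> 1"
  shows "t - \<sigma>\<^sup>2 / 2 * t\<^sup>2 \<le> some_child_prob p t"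
proof -
  have i: "integrable (measure_pmf p) (\<lambda>j. real j * (real j - 1))"
    using integrable_offspring by (simp add: algebra_simps power2_eq_square)
  have "t - \<sigma>\<^sup>2 / 2 * t\<^sup>2 = measure_pmf.expectation p (\<lambda>j. real j * t - real j * (real j - 1) * (t\<^sup>2 / 2))"
    using integrable_offspring i p_mean offspring_second_factorial_moment by simp
  also have "\<dots> \<le> some_child_prob p t" unfolding some_child_prob_def
  proof (rule integral_mono)
    show "real j * t - real j * (real j - 1) * (t\<^sup>2 / 2) \<le> 1 - (1 - t) ^ j" for j
      using power_one_minus_le[OF assms, of j] by simp
  qed (use integrable_offspring(1) i integrable_some_child_prob[OF assms] in simp_all)
  finally show ?thesis .
qed

definition offspring_moment3 where "offspring_moment3 = measure_pmf.expectation p (\<lambda>j. real j ^ 3)"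

lemma some_child_prob_le:
  assumes "0 \<le> t" "t \<le> 1"
  shows "some_child_prob p t \<le> t - \<sigma>\<^sup>2 / 2 * t\<^sup>2 + offspring_moment3 * t ^ 3"
proof -
  have i: "integrable (measure_pmf p) (\<lambda>j. real j * (real j - 1))"
    using integrable_offspring by (simp add: algebra_simps power2_eq_square)
  have "some_child_prob p t \<le> measure_pmf.expectation p
      (\<lambda>j. real j * t - real j * (real j - 1) * (t\<^sup>2 / 2) + real j ^ 3 * t ^ 3)" unfolding some_child_prob_def
  proof (rule integral_mono)
    show "1 - (1 - t) ^ j \<le> real j * t - real j * (real j - 1) * (t\<^sup>2 / 2) + real j ^ 3 * t ^ 3" for j
      using power_one_minus_ge[OF assms, of j] by simp
  qed (use integrable_offspring(1) i p_moment integrable_some_child_prob[OF assms] in simp_all)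
  also have "\<dots> = t - \<sigma>\<^sup>2 / 2 * t\<^sup>2 + offspring_moment3 * t ^ 3"
    using integrable_offspring i p_moment p_mean offspring_second_factorial_moment
    by (simp add: offspring_moment3_def)
  finally show ?thesis .
qed

text \<open>By Bernoulli, j t - (1 - (1 - t)^j) is nonnegative; at a fixed point its expectation is
  0, so it vanishes on the support. For t \<noteq> 0 and j \<ge> 2 it is at least t^2, so only j = 0
  and j = 1 are charged, contradicting the positive variance in the critical case.\<close>

lemma some_child_prob_fixed_point:
  assumes "0 \<le> t" "t \<le> 1" "some_child_prob p t = t"
  shows "t = 0"
proof (rule ccontr)
  assume "t \<noteq> 0"
  have "measure_pmf.expectation p (\<lambda>j. real j * t - (1 - (1 - t) ^ j)) = 0"
    using assms integrable_offspring integrable_some_child_prob[of t] p_mean by (simp add: some_child_prob_def)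
  moreover have nn: "0 \<le> real j * t - (1 - (1 - t) ^ j)" for j
    using Bernoulli_inequality[of "-t" j] assms by simp
  ultimately have "AE j in measure_pmf p. real j * t - (1 - (1 - t) ^ j) = 0"
    using assms integrable_offspring integrable_some_child_prob[of t]
    by (subst (asm) integral_nonneg_eq_0_iff_AE) auto
  then have eq: "real j * t - (1 - (1 - t) ^ j) = 0" if "j \<in> set_pmf p" for j
    using that by (simp add: AE_measure_pmf_iff)
  have "real j * (real j - 1) = 0" if "j \<in> set_pmf p" for j
  proof (rule ccontr)
    assume "real j * (real j - 1) \<noteq> 0"
    then obtain m where m: "j = Suc (Suc m)" by (metis One_nat_def diff_self mult_eq_0_iff
          not0_implies_Suc of_nat_0 of_nat_1)
    have "real j * t - (1 - (1 - t) ^ j)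
       = real m * t * t + t * t + (1 - t) * (real (Suc m) * t - (1 - (1 - t) ^ Suc m))"
      unfolding m by (simp add: algebra_simps)
    then have "real j * t - (1 - (1 - t) ^ j) \<ge> t * t"
      using nn[of "Suc m"] assms by (smt (verit) mult_nonneg_nonneg of_nat_0_le_iff)
    with eq[OF that] \<open>t \<noteq> 0\<close> show False by (metis mult_eq_0_iff not_square_less_zero order_le_less)
  qed
  then have "measure_pmf.expectation p (\<lambda>j. real j * (real j - 1)) = measure_pmf.expectation p (\<lambda>j. 0)"
    by (intro integral_cong_AE) (auto simp: AE_measure_pmf_iff)
  with offspring_second_factorial_moment p_var(2) show False by simp
qed

text \<open>Without positive steps, mean 0 would make the step vanish almost surely. The positive
  step drives the leftmost-maximiser argument in \<open>comparison\<close>.\<close>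

lemma exists_positive_step: "\<exists>k\<in>set_pmf a. k > 0"
proof (rule ccontr)
  assume neg: "\<not> (\<exists>k\<in>set_pmf a. k > 0)"
  have "measure_pmf.expectation a (\<lambda>k. - real_of_int k) = 0"
    using a_mean integrable_step_low_order by simp
  then have "AE k in measure_pmf a. - real_of_int k = 0"
    using neg integrable_step_low_order
    by (subst (asm) integral_nonneg_eq_0_iff_AE) (auto simp: AE_measure_pmf_iff not_less)
  then have "measure_pmf.expectation a (\<lambda>k. (real_of_int k)\<^sup>2) = measure_pmf.expectation a (\<lambda>k. 0)"
    by (intro integral_cong_AE) (auto simp: AE_measure_pmf_iff)
  with step_second_moment a_var(2) show False by simp
qed

lemma integrable_some_child_prob_step:
  assumes "\<And>k. 0 \<le> w k" "\<And>k. w k \<le> 1"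
  shows "integrable (measure_pmf a) (\<lambda>k. some_child_prob p (w k))"
  using some_child_prob_range assms by (intro measure_pmf.integrable_const_bound[where B=1]) auto

text \<open>
  At the leftmost maximiser \<open>y\<close> of \<open>w - v\<close> the 1-Lipschitz bound forces \<open>w - v\<close> to be maximal at
  \<open>y - k\<close> for every \<open>k\<close> charged by \<open>a\<close>, which is absurd for \<open>k > 0\<close>.
\<close>

lemma comparison:
  fixes w v :: "int \<Rightarrow> real"
  assumes w: "\<And>x. 0 \<le> w x" "\<And>x. w x \<le> 1" and v: "\<And>x. 0 \<le> v x" "\<And>x. v x \<le> 1"
    and boundary: "\<And>x. x \<le> x0 \<Longrightarrow> w x \<le> v x"
    and sub: "\<And>x. x > x0 \<Longrightarrow> w x \<le> measure_pmf.expectation a (\<lambda>k. some_child_prob p (w (x - k)))"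
    and super: "\<And>x. x > x0 \<Longrightarrow> measure_pmf.expectation a (\<lambda>k. some_child_prob p (v (x - k))) \<le> v x"
    and decay: "\<And>e. e > 0 \<Longrightarrow> \<exists>N. \<forall>x\<ge>N. w x \<le> e"
  shows "w x \<le> v x"
proof (rule ccontr)
  define D where "D x = w x - v x" for x
  assume "\<not> w x \<le> v x"
  then have x: "D x > 0" by (simp add: D_def)
  obtain N where N: "\<forall>y\<ge>N. w y \<le> D x / 2" using decay[of "D x / 2"] x by auto
  \<comment> \<open>This level set is bounded on the left by the boundary condition and on the right
    by the decay of \<open>w\<close> and \<open>v \<ge> 0\<close>; being finite, it makes the
    maximum of \<open>D\<close> attained.\<close>
  define S where "S = {y. D y \<ge> D x}"
  have "S \<subseteq> {x0..N}"
  proof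
    fix y assume "y \<in> S"
    then have y: "D y \<ge> D x" "D y > 0" using x by (auto simp: S_def)
    have "\<not> y \<le> x0" using boundary[of y] y by (auto simp: D_def)
    moreover have "\<not> y \<ge> N"
    proof
      assume "y \<ge> N"
      with N have "w y \<le> D x / 2" by blast
      with v(1)[of y] y(1) x show False by (simp add: D_def[of y])
    qed
    ultimately show "y \<in> {x0..N}" by auto
  qed
  then have fin: "finite S" by (rule finite_subset) simp
  have xS: "x \<in> S" by (simp add: S_def)
  define d where "d = Max (D ` S)"
  have dS: "d \<in> D ` S" using fin xS unfolding d_def by (intro Max_in) auto
  have d_max: "D y \<le> d" for y
  proof (cases "y \<in> S")
    case False
    then have "D y \<le> D x" by (simp add: S_def)
    also have "D x \<le> d" using fin xS by (simp add: d_def)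
    finally show ?thesis .
  qed (use fin in \<open>simp add: d_def\<close>)
  have dpos: "d > 0" using d_max[of x] x by simp
  define y where "y = Min {y \<in> S. D y = d}"
  have fin': "finite {y \<in> S. D y = d}" using fin by simp
  have y: "y \<in> {y \<in> S. D y = d}" unfolding y_def using dS fin' by (intro Min_in) auto
  obtain k where k: "k \<in> set_pmf a" "k > 0" using exists_positive_step by auto
  have "D (y - k) \<noteq> d"
  proof
    assume *: "D (y - k) = d"
    then have "y - k \<in> {y \<in> S. D y = d}" using d_max[of x] by (simp add: S_def)
    then have "y \<le> y - k" unfolding y_def using fin' by (rule Min_le[rotated])
    with k show False by simp
  qed
  with d_max[of "y - k"] have Dk: "D (y - k) < d" by simp
  have "y > x0" using y boundary[of y] dpos by (auto simp: D_def not_le[symmetric])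
  have iw: "integrable (measure_pmf a) (\<lambda>k. some_child_prob p (w (y - k)))"
    and iv: "integrable (measure_pmf a) (\<lambda>k. some_child_prob p (v (y - k)))"
    using w v by (auto intro!: integrable_some_child_prob_step)
  have iD: "integrable (measure_pmf a) (\<lambda>k. d - max 0 (D (y - k)))"
    using d_max dpos by (intro measure_pmf.integrable_const_bound[where B=d]) auto
  have "d = w y - v y" using y by (simp add: D_def)
  also have "\<dots> \<le> measure_pmf.expectation a (\<lambda>k. some_child_prob p (w (y - k)) - some_child_prob p (v (y - k)))"
    using sub[OF \<open>y > x0\<close>] super[OF \<open>y > x0\<close>] iw iv by simp
  \<comment> \<open>Writing the bound as \<open>d\<close> minus a nonnegative deficit shows that the
    deficit has expectation 0, hence vanishes wherever \<open>a\<close> has mass.\<close>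
  also have "\<dots> \<le> measure_pmf.expectation a (\<lambda>k. d - (d - max 0 (D (y - k))))"
  proof (rule integral_mono)
    show "integrable (measure_pmf a) (\<lambda>k. some_child_prob p (w (y - k)) - some_child_prob p (v (y - k)))"
      using iw iv by simp
    show "integrable (measure_pmf a) (\<lambda>k. d - (d - max 0 (D (y - k))))"
      using iD by (rule Bochner_Integration.integrable_diff[rotated]) simp
    show "some_child_prob p (w (y - k)) - some_child_prob p (v (y - k)) \<le> d - (d - max 0 (D (y - k)))" for k
      using some_child_prob_lipschitz_pos w v by (simp add: D_def)
  qed
  also have "\<dots> = d - measure_pmf.expectation a (\<lambda>k. d - max 0 (D (y - k)))"
    using iD by (subst Bochner_Integration.integral_diff) auto
  moreover have "0 \<le> measure_pmf.expectation a (\<lambda>k. d - max 0 (D (y - k)))"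
    using d_max dpos by (intro integral_nonneg_AE) auto
  ultimately have "measure_pmf.expectation a (\<lambda>k. d - max 0 (D (y - k))) = 0" by linarith
  then have "AE k in measure_pmf a. d - max 0 (D (y - k)) = 0"
    using iD d_max dpos by (subst (asm) integral_nonneg_eq_0_iff_AE) auto
  then have "d - max 0 (D (y - k)) = 0" using k by (auto simp: AE_measure_pmf_iff)
  with Dk dpos show False by linarith
qed

text \<open>The monotone limit can be passed through the recursion by dominated convergence, as Q is
  continuous. This supplies the decay hypothesis of \<open>comparison\<close>.\<close>

lemma solution_tendsto_zero:
  fixes u :: "int \<Rightarrow> real"
  assumes u: "\<And>x. 0 \<le> u x" "\<And>x. u x \<le> 1" and mono: "\<And>x y. x \<le> y \<Longrightarrow> u y \<le> u x"
    and eq: "\<And>x. x > 0 \<Longrightarrow> u x = measure_pmf.expectation a (\<lambda>k. some_child_prob p (u (x - k)))"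
    and "e > 0"
  shows "\<exists>N. \<forall>x\<ge>N. u x \<le> e"
proof -
  have "decseq (\<lambda>n. u (int n))" by (auto simp: decseq_def intro: mono)
  then obtain l where l: "(\<lambda>n. u (int n)) \<longlonglongrightarrow> l" and l_le: "\<And>n. l \<le> u (int n)"
    using u(1) decseq_convergent[of "\<lambda>n. u (int n)" 0] by blast
  have l01: "0 \<le> l" "l \<le> 1"
    using LIMSEQ_le_const[OF l, of 0] u(1) l_le[of 0] u(2)[of 0] by auto
  have l_lower: "l \<le> u x" for x
    by (rule order_trans[OF l_le[of "nat x"] mono]) simp
  have lim: "(\<lambda>n. u (int n - k)) \<longlonglongrightarrow> l" for k
  \<comment> \<open>The offset makes the argument at least \<open>n\<close>, so monotonicity
    squeezes the value between \<open>l\<close> and \<open>u (int n)\<close>.\<close>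
  proof (rule LIMSEQ_offset[of _ "nat k"])
    show "(\<lambda>n. u (int (n + nat k) - k)) \<longlonglongrightarrow> l"
    proof (rule tendsto_sandwich[OF _ _ tendsto_const l])
      show "\<forall>\<^sub>F n in sequentially. l \<le> u (int (n + nat k) - k)" by (simp add: l_lower)
      show "\<forall>\<^sub>F n in sequentially. u (int (n + nat k) - k) \<le> u (int n)"
        by (intro always_eventually allI mono) linarith
    qed
  qed
  have some_child_prob_lim: "(\<lambda>n. some_child_prob p (u (int n - k))) \<longlonglongrightarrow> some_child_prob p l" for k
  proof (rule tendsto_sandwich[OF _ _ tendsto_const])
    show "\<forall>\<^sub>F n in sequentially. some_child_prob p l \<le> some_child_prob p (u (int n - k))"
      by (intro always_eventually allI some_child_prob_mono l01 l_lower u)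
    show "\<forall>\<^sub>F n in sequentially. some_child_prob p (u (int n - k)) \<le> some_child_prob p l + (u (int n - k) - l)"
      using some_child_prob_lipschitz[of l] l01 l_lower u
      by (intro always_eventually allI) (smt (verit))
    show "(\<lambda>n. some_child_prob p l + (u (int n - k) - l)) \<longlonglongrightarrow> some_child_prob p l"
      using tendsto_add[OF tendsto_const tendsto_diff[OF lim tendsto_const], of "some_child_prob p l" k l] by simp
  qed
  have "(\<lambda>n. measure_pmf.expectation a (\<lambda>k. some_child_prob p (u (int n - k))))
      \<longlonglongrightarrow> measure_pmf.expectation a (\<lambda>k. some_child_prob p l)"
    using some_child_prob_lim some_child_prob_range u
    by (intro integral_dominated_convergence[where w="\<lambda>_. 1"]) auto
  moreover have "\<forall>\<^sub>F n in sequentially. measure_pmf.expectation a (\<lambda>k. some_child_prob p (u (int n - k))) = u (int n)"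
    using eventually_gt_at_top[of 0] by eventually_elim (simp add: eq)
  ultimately have "(\<lambda>n. u (int n)) \<longlonglongrightarrow> some_child_prob p l"
    using Lim_transform_eventually by fastforce
  then have "some_child_prob p l = l" using l LIMSEQ_unique by blast
  then have "l = 0" using some_child_prob_fixed_point l01 by blast
  with l \<open>e > 0\<close> have "\<forall>\<^sub>F n in sequentially. u (int n) < e" by (auto simp: order_tendsto_iff)
  then obtain n where "u (int n) < e" by (auto simp: eventually_sequentially)
  then have "\<forall>x\<ge>int n. u x \<le> e" using mono by (smt (verit))
  then show ?thesis by blast
qed

section \<open>Inverse-square sub- and supersolutions\<close>

definition "step_moment1 = measure_pmf.expectation a (\<lambda>k. \<bar>real_of_int k\<bar>)"
definition "step_moment3 = measure_pmf.expectation a (\<lambda>k. \<bar>real_of_int k\<bar> ^ 3)"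
definition "step_moment_r = measure_pmf.expectation a (\<lambda>k. \<bar>real_of_int k\<bar> powr r)"

text \<open>
  Jumps beyond \<open>z / 2\<close> cost \<open>O(z powr -r) = o(z ^ -4)\<close>; this is where \<open>r > 4\<close> enters.
\<close>

lemma expectation_upper_profile:
  fixes v :: "int \<Rightarrow> real"
  assumes v: "\<And>k. 0 \<le> v k" "\<And>k. v k \<le> 1" and c: "c > 0" and z: "z > 0" "c / (z / 2)\<^sup>2 \<le> 1"
    and le: "\<And>k. real_of_int k \<le> z / 2 \<Longrightarrow> v k \<le> c / (z - k)\<^sup>2"
  shows "measure_pmf.expectation a (\<lambda>k. some_child_prob p (v k)) \<le>
     (2 / z) powr r * step_moment_r + c / z\<^sup>2 * (1 + 3 * \<eta>\<^sup>2 / z\<^sup>2 + 16 * step_moment3 / z ^ 3)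
     - \<sigma>\<^sup>2 / 2 * (c / z\<^sup>2)\<^sup>2 * (1 - 4 * step_moment1 / z) + 64 * offspring_moment3 * (c / z\<^sup>2) ^ 3"
proof -
  \<comment> \<open>An explicit majorant in the jump \<open>k\<close>: a tail term plus the
    expansions of \<open>inverse_square_upper\<close> and \<open>inverse_fourth_power_lower\<close>.
    Its expectation involves only moments of \<open>a\<close>, and the linear term drops out by mean
    0.\<close>
  define F where "F k = (2 / z) powr r * \<bar>real_of_int k\<bar> powr r
     + c / z\<^sup>2 * (1 + (2 / z) * real_of_int k + (3 / z\<^sup>2) * (real_of_int k)\<^sup>2 + (16 / z ^ 3) * \<bar>real_of_int k\<bar> ^ 3)
     - \<sigma>\<^sup>2 / 2 * (c / z\<^sup>2)\<^sup>2 * (1 - (4 / z) * \<bar>real_of_int k\<bar>) + 64 * offspring_moment3 * (c / z\<^sup>2) ^ 3" for k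
  have C0: "offspring_moment3 \<ge> 0" unfolding offspring_moment3_def by (intro integral_nonneg_AE) auto
  have "some_child_prob p (v k) \<le> F k" for k
  proof -
    define h where "h = real_of_int k / z"
    have F: "F k = (2 * \<bar>h\<bar>) powr r + c / z\<^sup>2 * (1 + 2 * h + 3 * h\<^sup>2 + 16 * \<bar>h\<bar> ^ 3)
      - \<sigma>\<^sup>2 / 2 * (c / z\<^sup>2)\<^sup>2 * (1 - 4 * \<bar>h\<bar>) + 64 * offspring_moment3 * (c / z\<^sup>2) ^ 3"
      using z by (simp add: F_def h_def power_divide abs_divide powr_mult powr_divide)
    show ?thesis
    proof (cases "real_of_int k \<le> z / 2")
      case True
      then have h: "h \<le> 1 / 2" using z by (simp add: h_def field_simps)
      define g where "g = c / (z - k)\<^sup>2"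
      have g: "g = c / z\<^sup>2 * (1 / (1 - h)\<^sup>2)"
        using inverse_square_rescale[of z k c] True z by (simp add: g_def h_def)
      have "(z / 2)\<^sup>2 \<le> (z - k)\<^sup>2" using True z by (intro power_mono) auto
      then have "g \<le> c / (z / 2)\<^sup>2" unfolding g_def using c z by (intro divide_left_mono) (auto intro!: mult_pos_pos)
      \<comment> \<open>The factor 4 from halving \<open>z\<close> becomes 64 in the cubic error
        term.\<close>
      then have g1: "g \<le> 1" "g \<le> 4 * (c / z\<^sup>2)" using z(2) by (auto simp: power_divide mult.commute)
      have g0: "0 \<le> g" using c by (simp add: g_def)
      have "some_child_prob p (v k) \<le> some_child_prob p g" using v le[OF True] g1 by (intro some_child_prob_mono) (auto simp: g_def)
      also have "\<dots> \<le> g - \<sigma>\<^sup>2 / 2 * g\<^sup>2 + offspring_moment3 * g ^ 3" using g0 g1 by (intro some_child_prob_le)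
      also have "\<dots> \<le> c / z\<^sup>2 * (1 + 2 * h + 3 * h\<^sup>2 + 16 * \<bar>h\<bar> ^ 3)
         - \<sigma>\<^sup>2 / 2 * ((c / z\<^sup>2)\<^sup>2 * (1 - 4 * \<bar>h\<bar>)) + offspring_moment3 * (4 * (c / z\<^sup>2)) ^ 3"
      proof (intro add_mono diff_mono mult_left_mono)
        show "g \<le> c / z\<^sup>2 * (1 + 2 * h + 3 * h\<^sup>2 + 16 * \<bar>h\<bar> ^ 3)"
          unfolding g using inverse_square_upper[OF h] c by (intro mult_left_mono) auto
        show "(c / z\<^sup>2)\<^sup>2 * (1 - 4 * \<bar>h\<bar>) \<le> g\<^sup>2"
          unfolding g power_mult_distrib using inverse_fourth_power_lower[OF h] by (intro mult_left_mono) auto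
        show "g ^ 3 \<le> (4 * (c / z\<^sup>2)) ^ 3" using g0 g1 by (intro power_mono)
      qed (use C0 in auto)
      also have "(4 * (c / z\<^sup>2)) ^ 3 = 64 * (c / z\<^sup>2) ^ 3" by (subst power_mult_distrib) simp
      also have "c / z\<^sup>2 * (1 + 2 * h + 3 * h\<^sup>2 + 16 * \<bar>h\<bar> ^ 3)
         - \<sigma>\<^sup>2 / 2 * ((c / z\<^sup>2)\<^sup>2 * (1 - 4 * \<bar>h\<bar>)) + offspring_moment3 * (64 * (c / z\<^sup>2) ^ 3) = F k - (2 * \<bar>h\<bar>) powr r"
        unfolding F by (simp add: mult_ac)
      also have "\<dots> \<le> F k" by simp
      finally show ?thesis .
    next
      case False
      then have h: "h > 1 / 2" using z by (simp add: h_def field_simps)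
      have "some_child_prob p (v k) \<le> 1" using some_child_prob_range v by blast
      \<comment> \<open>Markov-type bound: on large jumps the tail term alone dominates a
        probability. The other terms of \<open>F k\<close> are nonnegative, since 1 - 4 |h| is
        negative there.\<close>
      also have "1 \<le> (2 * \<bar>h\<bar>) powr r" using h a_moment(1) by (intro ge_one_powr_ge_zero) auto
      also have "\<dots> \<le> F k"
      proof -
        have "0 \<le> c / z\<^sup>2 * (1 + 2 * h + 3 * h\<^sup>2 + 16 * \<bar>h\<bar> ^ 3)" using c h by (intro mult_nonneg_nonneg) auto
        moreover have "\<sigma>\<^sup>2 / 2 * (c / z\<^sup>2)\<^sup>2 * (1 - 4 * \<bar>h\<bar>) \<le> 0" using h by (intro mult_nonneg_nonpos) auto
        moreover have "0 \<le> 64 * offspring_moment3 * (c / z\<^sup>2) ^ 3" using C0 c by (intro mult_nonneg_nonneg) auto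
        ultimately show ?thesis unfolding F by linarith
      qed
      finally show ?thesis .
    qed
  qed
  moreover have i: "integrable (measure_pmf a) F" unfolding F_def
    using integrable_step_low_order integrable_step[of 3] a_moment(2) by simp
  ultimately have "measure_pmf.expectation a (\<lambda>k. some_child_prob p (v k)) \<le> measure_pmf.expectation a F"
    using integrable_some_child_prob_step[of v] v by (intro integral_mono) auto
  also have "\<dots> = (2 / z) powr r * step_moment_r + c / z\<^sup>2 * (1 + 3 * \<eta>\<^sup>2 / z\<^sup>2 + 16 * step_moment3 / z ^ 3)
     - \<sigma>\<^sup>2 / 2 * (c / z\<^sup>2)\<^sup>2 * (1 - 4 * step_moment1 / z) + 64 * offspring_moment3 * (c / z\<^sup>2) ^ 3"
    unfolding F_def using integrable_step_low_order integrable_step[of 3] a_moment(2)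
    by (simp add: step_moment1_def step_moment3_def step_moment_r_def a_mean step_second_moment)
  finally show ?thesis .
qed

text \<open>For jumps of at least \<open>z / 2\<close> the minorant is already nonpositive by
  \<open>inverse_square_lower_big\<close>, while Q is nonnegative, so no tail term arises.\<close>

lemma expectation_lower_profile:
  fixes v :: "int \<Rightarrow> real"
  assumes v: "\<And>k. 0 \<le> v k" "\<And>k. v k \<le> 1" and c: "c > 0" and z: "z > 0" "c / (z / 2)\<^sup>2 \<le> 1"
    and ge: "\<And>k. real_of_int k < z / 2 \<Longrightarrow> c / (z - k)\<^sup>2 \<le> v k"
  shows "c / z\<^sup>2 * (1 + 3 * \<eta>\<^sup>2 / z\<^sup>2 - 22 * step_moment3 / z ^ 3)
     - \<sigma>\<^sup>2 / 2 * (c / z\<^sup>2)\<^sup>2 * (1 + 30 * step_moment1 / z) \<le> measure_pmf.expectation a (\<lambda>k. some_child_prob p (v k))"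
proof -
  define F where "F k = c / z\<^sup>2 * (1 + (2 / z) * real_of_int k + (3 / z\<^sup>2) * (real_of_int k)\<^sup>2 - (22 / z ^ 3) * \<bar>real_of_int k\<bar> ^ 3)
     - \<sigma>\<^sup>2 / 2 * (c / z\<^sup>2)\<^sup>2 * (1 + (30 / z) * \<bar>real_of_int k\<bar>)" for k
  have "F k \<le> some_child_prob p (v k)" for k
  proof -
    define h where "h = real_of_int k / z"
    have F: "F k = c / z\<^sup>2 * (1 + 2 * h + 3 * h\<^sup>2 - 22 * \<bar>h\<bar> ^ 3)
      - \<sigma>\<^sup>2 / 2 * (c / z\<^sup>2)\<^sup>2 * (1 + 30 * \<bar>h\<bar>)"
      using z by (simp add: F_def h_def power_divide abs_divide)
    show ?thesis
    proof (cases "real_of_int k < z / 2")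
      case True
      then have h: "h < 1 / 2" using z by (simp add: h_def field_simps)
      define g where "g = c / (z - k)\<^sup>2"
      have g: "g = c / z\<^sup>2 * (1 / (1 - h)\<^sup>2)"
        using inverse_square_rescale[of z k c] True z by (simp add: g_def h_def)
      have "(z / 2)\<^sup>2 \<le> (z - k)\<^sup>2" using True z by (intro power_mono) auto
      then have "g \<le> c / (z / 2)\<^sup>2" unfolding g_def using c z by (intro divide_left_mono) (auto intro!: mult_pos_pos)
      then have g1: "g \<le> 1" using z(2) by simp
      have g0: "0 \<le> g" using c by (simp add: g_def)
      have "F k = c / z\<^sup>2 * (1 + 2 * h + 3 * h\<^sup>2 - 22 * \<bar>h\<bar> ^ 3)
         - \<sigma>\<^sup>2 / 2 * ((c / z\<^sup>2)\<^sup>2 * (1 + 30 * \<bar>h\<bar>))" unfolding F by simp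
      also have "\<dots> \<le> g - \<sigma>\<^sup>2 / 2 * g\<^sup>2"
      proof (intro diff_mono mult_left_mono)
        show "c / z\<^sup>2 * (1 + 2 * h + 3 * h\<^sup>2 - 22 * \<bar>h\<bar> ^ 3) \<le> g"
          unfolding g using inverse_square_lower[OF h] c by (intro mult_left_mono) auto
        show "g\<^sup>2 \<le> (c / z\<^sup>2)\<^sup>2 * (1 + 30 * \<bar>h\<bar>)"
          unfolding g power_mult_distrib using inverse_fourth_power_upper[OF h] by (intro mult_left_mono) auto
      qed auto
      also have "\<dots> \<le> some_child_prob p g" using g0 g1 by (intro some_child_prob_ge)
      also have "\<dots> \<le> some_child_prob p (v k)" using ge[OF True] v g0 by (intro some_child_prob_mono) (auto simp: g_def)
      finally show ?thesis .
    next
      case False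
      then have h: "h \<ge> 1 / 2" using z by (simp add: h_def field_simps)
      have "c / z\<^sup>2 * (1 + 2 * h + 3 * h\<^sup>2 - 22 * \<bar>h\<bar> ^ 3) \<le> 0"
        using c inverse_square_lower_big[OF h] by (intro mult_nonneg_nonpos) auto
      moreover have "0 \<le> \<sigma>\<^sup>2 / 2 * (c / z\<^sup>2)\<^sup>2 * (1 + 30 * \<bar>h\<bar>)" by (intro mult_nonneg_nonneg) auto
      moreover have "0 \<le> some_child_prob p (v k)" using some_child_prob_range v by blast
      ultimately show ?thesis unfolding F by linarith
    qed
  qed
  moreover have i: "integrable (measure_pmf a) F" unfolding F_def
    using integrable_step_low_order integrable_step[of 3] by simp
  ultimately have "measure_pmf.expectation a F \<le> measure_pmf.expectation a (\<lambda>k. some_child_prob p (v k))"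
    using integrable_some_child_prob_step[of v] v by (intro integral_mono) auto
  also have "measure_pmf.expectation a F = c / z\<^sup>2 * (1 + 3 * \<eta>\<^sup>2 / z\<^sup>2 - 22 * step_moment3 / z ^ 3)
     - \<sigma>\<^sup>2 / 2 * (c / z\<^sup>2)\<^sup>2 * (1 + 30 * step_moment1 / z)"
    unfolding F_def using integrable_step_low_order integrable_step[of 3]
    by (simp add: step_moment1_def step_moment3_def a_mean step_second_moment)
  finally show ?thesis .
qed

text \<open>After subtracting c / z^2 and multiplying by z^4, what remains is \<open>H\<close>. Its
  tail term is of order z^(4 - r), which tends to 0, and its limit 3 \<eta>^2 c - \<sigma>^2 c^2 / 2
  is negative exactly above the critical constant, for c > 0.\<close>

lemma eventually_upper_profile:
  assumes c: "c > 6 * \<eta>\<^sup>2 / \<sigma>\<^sup>2" "c > 0"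
  shows "\<forall>\<^sub>F z in at_top. (2 / z) powr r * step_moment_r + c / z\<^sup>2 * (1 + 3 * \<eta>\<^sup>2 / z\<^sup>2 + 16 * step_moment3 / z ^ 3)
     - \<sigma>\<^sup>2 / 2 * (c / z\<^sup>2)\<^sup>2 * (1 - 4 * step_moment1 / z) + 64 * offspring_moment3 * (c / z\<^sup>2) ^ 3 \<le> c / z\<^sup>2"
proof -
  define H where "H z = 2 powr r * step_moment_r * z powr (4 - r) + (c * (3 * \<eta>\<^sup>2) + 16 * step_moment3 * c / z
    - \<sigma>\<^sup>2 / 2 * c\<^sup>2 * (1 - 4 * step_moment1 / z) + 64 * offspring_moment3 * c ^ 3 / z\<^sup>2)" for z
  have "((\<lambda>z. z powr (4 - r)) \<longlongrightarrow> 0) at_top"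
    using a_moment(1) by (intro tendsto_neg_powr filterlim_ident) simp
  moreover have "((\<lambda>z. c * (3 * \<eta>\<^sup>2) + 16 * step_moment3 * c / z - \<sigma>\<^sup>2 / 2 * c\<^sup>2 * (1 - 4 * step_moment1 / z)
      + 64 * offspring_moment3 * c ^ 3 / z\<^sup>2) \<longlongrightarrow> c * (3 * \<eta>\<^sup>2) - \<sigma>\<^sup>2 / 2 * c\<^sup>2) at_top"
    by real_asymp
  ultimately have "(H \<longlongrightarrow> 2 powr r * step_moment_r * 0 + (c * (3 * \<eta>\<^sup>2) - \<sigma>\<^sup>2 / 2 * c\<^sup>2)) at_top"
    unfolding H_def by (intro tendsto_add tendsto_mult tendsto_const)
  moreover have "2 powr r * step_moment_r * 0 + (c * (3 * \<eta>\<^sup>2) - \<sigma>\<^sup>2 / 2 * c\<^sup>2) < 0"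
  proof -
    have "6 * \<eta>\<^sup>2 < c * \<sigma>\<^sup>2" using c p_var(2) by (simp add: pos_divide_less_eq)
    then have "c / 2 * (6 * \<eta>\<^sup>2) < c / 2 * (c * \<sigma>\<^sup>2)" using c by (intro mult_strict_left_mono) auto
    then show ?thesis by (simp add: power2_eq_square mult_ac)
  qed
  ultimately have "\<forall>\<^sub>F z in at_top. H z < 0" by (rule order_tendstoD)
  then show ?thesis using eventually_gt_at_top[of 0]
  proof eventually_elim
    case (elim z)
    have "(2 / z) powr r = 2 powr r * z powr (4 - r) / z ^ 4"
      using elim by (simp add: powr_divide powr_diff powr_realpow)
    then have "(2 / z) powr r * step_moment_r + c / z\<^sup>2 * (1 + 3 * \<eta>\<^sup>2 / z\<^sup>2 + 16 * step_moment3 / z ^ 3)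
       - \<sigma>\<^sup>2 / 2 * (c / z\<^sup>2)\<^sup>2 * (1 - 4 * step_moment1 / z) + 64 * offspring_moment3 * (c / z\<^sup>2) ^ 3 = c / z\<^sup>2 + H z / z ^ 4"
      using elim by (simp add: H_def field_simps power2_eq_square power3_eq_cube power4_eq_xxxx)
    moreover have "H z / z ^ 4 \<le> 0" using elim by (intro divide_nonpos_pos) auto
    ultimately show ?case by linarith
  qed
qed

lemma eventually_lower_profile:
  assumes c: "c < 6 * \<eta>\<^sup>2 / \<sigma>\<^sup>2" "c > 0"
  shows "\<forall>\<^sub>F z in at_top. c / z\<^sup>2 \<le> c / z\<^sup>2 * (1 + 3 * \<eta>\<^sup>2 / z\<^sup>2 - 22 * step_moment3 / z ^ 3)
     - \<sigma>\<^sup>2 / 2 * (c / z\<^sup>2)\<^sup>2 * (1 + 30 * step_moment1 / z)"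
proof -
  define H where "H z = c * (3 * \<eta>\<^sup>2) - 22 * step_moment3 * c / z - \<sigma>\<^sup>2 / 2 * c\<^sup>2 * (1 + 30 * step_moment1 / z)" for z
  have "(H \<longlongrightarrow> c * (3 * \<eta>\<^sup>2) - \<sigma>\<^sup>2 / 2 * c\<^sup>2) at_top"
    unfolding H_def by real_asymp
  moreover have "c * (3 * \<eta>\<^sup>2) - \<sigma>\<^sup>2 / 2 * c\<^sup>2 > 0"
  proof -
    have "6 * \<eta>\<^sup>2 > c * \<sigma>\<^sup>2" using c p_var(2) by (simp add: pos_less_divide_eq)
    then have "c / 2 * (6 * \<eta>\<^sup>2) > c / 2 * (c * \<sigma>\<^sup>2)" using c by (intro mult_strict_left_mono) auto
    then show ?thesis by (simp add: power2_eq_square mult_ac)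
  qed
  ultimately have "\<forall>\<^sub>F z in at_top. H z > 0" by (rule order_tendstoD)
  then show ?thesis using eventually_gt_at_top[of 0]
  proof eventually_elim
    case (elim z)
    have "c / z\<^sup>2 * (1 + 3 * \<eta>\<^sup>2 / z\<^sup>2 - 22 * step_moment3 / z ^ 3)
       - \<sigma>\<^sup>2 / 2 * (c / z\<^sup>2)\<^sup>2 * (1 + 30 * step_moment1 / z) = c / z\<^sup>2 + H z / z ^ 4"
      using elim by (simp add: H_def field_simps power2_eq_square power3_eq_cube power4_eq_xxxx)
    moreover have "H z / z ^ 4 \<ge> 0" using elim by (intro divide_nonneg_pos) auto
    ultimately show ?case by linarith
  qed
qed

section \<open>Two-sided bounds for an abstract solution of the recursion\<close>

context
  fixes u :: "int \<Rightarrow> real"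
  assumes u: "\<And>x. 0 \<le> u x" "\<And>x. u x \<le> 1" and u_mono: "\<And>x y. x \<le> y \<Longrightarrow> u y \<le> u x"
    and u_nonpos: "\<And>x. x \<le> 0 \<Longrightarrow> u x = 1"
    and u_eq: "\<And>x. x > 0 \<Longrightarrow> u x = measure_pmf.expectation a (\<lambda>k. some_child_prob p (u (x - k)))"
begin

lemma solution_upper:
  assumes c: "c > 6 * \<eta>\<^sup>2 / \<sigma>\<^sup>2" "c > 0"
  shows "\<exists>s N. \<forall>x\<ge>N. s < real_of_int x \<and> u x \<le> c / (real_of_int x - s)\<^sup>2"
proof -
  let ?G = "\<lambda>z. (2 / z) powr r * step_moment_r + c / z\<^sup>2 * (1 + 3 * \<eta>\<^sup>2 / z\<^sup>2 + 16 * step_moment3 / z ^ 3)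
     - \<sigma>\<^sup>2 / 2 * (c / z\<^sup>2)\<^sup>2 * (1 - 4 * step_moment1 / z) + 64 * offspring_moment3 * (c / z\<^sup>2) ^ 3"
  obtain Z where Z: "Z > 0" "\<And>z. z \<ge> Z \<Longrightarrow> ?G z \<le> c / z\<^sup>2" "\<And>z. z \<ge> Z \<Longrightarrow> c / (z / 2)\<^sup>2 \<le> 1"
  proof -
    have "\<forall>\<^sub>F z in at_top. z > 0 \<and> ?G z \<le> c / z\<^sup>2 \<and> c / (z / 2)\<^sup>2 \<le> 1"
      by (intro eventually_conj eventually_upper_profile[OF c] eventually_small_profile eventually_gt_at_top)
    then obtain N where "\<forall>z\<ge>N. z > 0 \<and> ?G z \<le> c / z\<^sup>2 \<and> c / (z / 2)\<^sup>2 \<le> 1"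
      unfolding eventually_at_top_linorder by blast
    then show ?thesis using that[of N] by blast
  qed
  have "c / Z\<^sup>2 > 0" using c Z by simp
  then obtain X0 where X0: "\<forall>x\<ge>X0. u x \<le> c / Z\<^sup>2"
    using solution_tendsto_zero[of u "c / Z\<^sup>2"] u u_mono u_eq by blast
  \<comment> \<open>Far out \<open>u \<le> c / Z\<^sup>2\<close>; beyond that point the plateau of \<open>w\<close> at height \<open>c / Z\<^sup>2\<close> has length
    \<open>Z / 2\<close>, so that jumps of size at most \<open>z / 2\<close> from the decaying part do not reach \<open>w = 1\<close>.\<close>
  define X where "X = max 0 X0"
  \<comment> \<open>With this shift, \<open>y > X\<close> means \<open>y - s > Z / 2\<close>, and
    the plateau ends where \<open>y - s = Z\<close>, so \<open>w\<close> joins the decaying part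
    continuously.\<close>
  define s where "s = real_of_int X - Z / 2"
  define w where "w y = (if y \<le> X then 1 else if y - s \<le> Z then c / Z\<^sup>2 else c / (y - s)\<^sup>2)" for y :: int
  have cZ: "c / Z\<^sup>2 \<le> 1" using Z(3)[of Z] c Z(1) by (simp add: power_divide)
  have w_le: "w y \<le> c / (y - s)\<^sup>2" if "y - s > Z / 2" for y :: int
  proof -
    have "y > X" using that by (simp add: s_def)
    moreover have "c / Z\<^sup>2 \<le> c / (y - s)\<^sup>2" if "y - s \<le> Z"
      using that \<open>y - s > Z / 2\<close> Z(1) c by (intro divide_left_mono power_mono) auto
    ultimately show ?thesis by (auto simp: w_def)
  qed
  have w01: "0 \<le> w y" "w y \<le> 1" for y
  proof -
    have "c / (y - s)\<^sup>2 \<le> c / Z\<^sup>2" if "y - s > Z"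
      using that Z(1) c by (intro divide_left_mono power_mono) auto
    with cZ show "w y \<le> 1" by (auto simp: w_def)
    show "0 \<le> w y" using c by (simp add: w_def)
  qed
  have "u x \<le> w x" for x
  \<comment> \<open>The supersolution property is claimed only on the decaying part; on the left,
    \<open>u \<le> w\<close> holds by \<open>u \<le> 1\<close> up to \<open>X\<close> and by the
    choice of \<open>X0\<close> on the plateau.\<close>
  proof (rule comparison[of u w "\<lfloor>s + Z\<rfloor>"])
    fix x assume "x \<le> \<lfloor>s + Z\<rfloor>"
    then have "x - s \<le> Z" by linarith
    then show "u x \<le> w x" using u(2) X0 by (auto simp: w_def X_def)
  next
    fix x assume x: "x > \<lfloor>s + Z\<rfloor>"
    then have xs: "x - s > Z" by linarith
    then have "x > X" using Z(1) by (simp add: s_def)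
    then have "x > 0" by (simp add: X_def)
    then show "u x \<le> measure_pmf.expectation a (\<lambda>k. some_child_prob p (u (x - k)))" using u_eq by simp
    have "measure_pmf.expectation a (\<lambda>k. some_child_prob p (w (x - k))) \<le> ?G (x - s)"
    proof (rule expectation_upper_profile)
      fix k :: int assume "real_of_int k \<le> (real_of_int x - s) / 2"
      then have "real_of_int (x - k) - s > Z / 2" using xs by simp
      then have "w (x - k) \<le> c / (real_of_int (x - k) - s)\<^sup>2" by (rule w_le)
      also have "real_of_int (x - k) - s = real_of_int x - s - k" by simp
      finally show "w (x - k) \<le> c / (real_of_int x - s - k)\<^sup>2" .
    qed (use w01 c xs Z in auto)
    also have "\<dots> \<le> c / (x - s)\<^sup>2" using Z(2)[of "x - s"] xs by simp
    also have "\<dots> = w x" using xs \<open>x > X\<close> by (simp add: w_def)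
    finally show "measure_pmf.expectation a (\<lambda>k. some_child_prob p (w (x - k))) \<le> w x" .
  qed (use u w01 solution_tendsto_zero[of u] u_mono u_eq in blast)+
  then have "s < x \<and> u x \<le> c / (x - s)\<^sup>2" if "x \<ge> \<lceil>s + Z\<rceil>" for x
  proof -
    have "x - s > Z / 2" using that Z(1) by linarith
    with \<open>\<And>x. u x \<le> w x\<close>[of x] w_le[of x] Z(1) show ?thesis by linarith
  qed
  then show ?thesis by blast
qed

text \<open>Here the boundary is easy: \<open>u = 1\<close> on \<open>x \<le> 0\<close>, so any
  subsolution with values at most 1 starts below \<open>u\<close>. The profile is cut to 0 where
  \<open>x + Z\<close> is at most \<open>Z / 2\<close>, and jumps shorter than half of
  \<open>x + Z\<close> from a positive \<open>x\<close> never enter that region.\<close>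

lemma solution_lower:
  assumes c: "c < 6 * \<eta>\<^sup>2 / \<sigma>\<^sup>2" "c > 0"
  shows "\<exists>s>0. \<forall>x>0. c / (real_of_int x + s)\<^sup>2 \<le> u x"
proof -
  let ?G = "\<lambda>z. c / z\<^sup>2 * (1 + 3 * \<eta>\<^sup>2 / z\<^sup>2 - 22 * step_moment3 / z ^ 3)
     - \<sigma>\<^sup>2 / 2 * (c / z\<^sup>2)\<^sup>2 * (1 + 30 * step_moment1 / z)"
  obtain Z where Z: "Z > 0" "\<And>z. z \<ge> Z \<Longrightarrow> c / z\<^sup>2 \<le> ?G z" "\<And>z. z \<ge> Z \<Longrightarrow> c / (z / 2)\<^sup>2 \<le> 1"
  proof -
    have "\<forall>\<^sub>F z in at_top. z > 0 \<and> c / z\<^sup>2 \<le> ?G z \<and> c / (z / 2)\<^sup>2 \<le> 1"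
      by (intro eventually_conj eventually_lower_profile[OF c] eventually_small_profile eventually_gt_at_top)
    then obtain N where "\<forall>z\<ge>N. z > 0 \<and> c / z\<^sup>2 \<le> ?G z \<and> c / (z / 2)\<^sup>2 \<le> 1"
      unfolding eventually_at_top_linorder by blast
    then show ?thesis using that[of N] by blast
  qed
  define w where "w y = (if y + Z > Z / 2 then c / (y + Z)\<^sup>2 else 0)" for y :: int
  have w01: "0 \<le> w y" "w y \<le> 1" for y
  proof -
    have "c / (y + Z)\<^sup>2 \<le> c / (Z / 2)\<^sup>2" if "y + Z > Z / 2"
      using that Z(1) c by (intro divide_left_mono power_mono) auto
    with Z(3)[of Z] show "w y \<le> 1" by (auto simp: w_def)
    show "0 \<le> w y" using c by (simp add: w_def)
  qed
  have "w x \<le> u x" for x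
  proof (rule comparison[of w u 0])
    fix x :: int assume "x \<le> 0"
    then show "w x \<le> u x" using w01 u_nonpos by simp
  next
    fix x :: int assume x: "x > 0"
    then show "measure_pmf.expectation a (\<lambda>k. some_child_prob p (u (x - k))) \<le> u x" using u_eq by simp
    have "w x = c / (x + Z)\<^sup>2" using x Z(1) by (simp add: w_def)
    also have "\<dots> \<le> ?G (x + Z)" using Z(2)[of "x + Z"] x by simp
    also have "\<dots> \<le> measure_pmf.expectation a (\<lambda>k. some_child_prob p (w (x - k)))"
    proof (rule expectation_lower_profile)
      fix k :: int assume "real_of_int k < (real_of_int x + Z) / 2"
      then have "real_of_int (x - k) + Z > Z / 2" using x by simp
      then have "w (x - k) = c / (real_of_int (x - k) + Z)\<^sup>2" by (simp add: w_def)
      also have "real_of_int (x - k) + Z = real_of_int x + Z - k" by simp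
      finally show "c / (real_of_int x + Z - k)\<^sup>2 \<le> w (x - k)" by simp
    qed (use w01 c x Z in auto)
    finally show "w x \<le> measure_pmf.expectation a (\<lambda>k. some_child_prob p (w (x - k)))" .
  next
    fix e :: real assume "e > 0"
    have "((\<lambda>y. c / (y + Z)\<^sup>2) \<longlongrightarrow> 0) at_top" by real_asymp
    then have "\<forall>\<^sub>F y in at_top. c / (y + Z)\<^sup>2 < e" using \<open>e > 0\<close> by (rule order_tendstoD)
    then obtain N where N: "\<And>y. y \<ge> N \<Longrightarrow> c / (y + Z)\<^sup>2 < e" by (auto simp: eventually_at_top_linorder)
    have "w x \<le> e" if "x \<ge> \<lceil>N\<rceil>" for x
    proof -
      have "real_of_int x \<ge> N" using that by linarith
      with N[of x] \<open>e > 0\<close> show ?thesis by (simp add: w_def)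
    qed
    then show "\<exists>N. \<forall>x\<ge>N. w x \<le> e" by blast
  qed (use u w01 in blast)+
  then have "c / (x + Z)\<^sup>2 \<le> u x" if "x > 0" for x
    using that Z(1) \<open>\<And>x. w x \<le> u x\<close>[of x] by (simp add: w_def)
  with Z(1) show ?thesis by blast
qed

lemma solution_asymptotics:
  "(\<lambda>x::real. u \<lceil>x\<rceil>) \<sim>[at_top] (\<lambda>x. 6 * \<eta>\<^sup>2 / (\<sigma>\<^sup>2 * x\<^sup>2))"
proof -
  define c0 where "c0 = 6 * \<eta>\<^sup>2 / \<sigma>\<^sup>2"
  have c0: "c0 > 0" using a_var(2) p_var(2) by (simp add: c0_def)
  have "((\<lambda>x::real. u \<lceil>x\<rceil> * x\<^sup>2) \<longlongrightarrow> c0) at_top"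
  proof (rule order_tendstoI)
    fix b assume b: "c0 < b"
    \<comment> \<open>A constant strictly between \<open>c0\<close> and \<open>b\<close> leaves room
      for the shift \<open>s\<close>, whose effect disappears in the limit.\<close>
    define c where "c = (c0 + b) / 2"
    have c: "c0 < c" "c < b" "c > 0" using b c0 by (auto simp: c_def)
    obtain s N where sN: "\<forall>x\<ge>N. s < real_of_int x \<and> u x \<le> c / (real_of_int x - s)\<^sup>2"
      using solution_upper[of c] c by (auto simp: c0_def)
    have "((\<lambda>x. c * x\<^sup>2 / (x - s)\<^sup>2) \<longlongrightarrow> c) at_top" using c by real_asymp
    then have "\<forall>\<^sub>F x in at_top. c * x\<^sup>2 / (x - s)\<^sup>2 < b" using c(2) by (rule order_tendstoD)
    then show "\<forall>\<^sub>F x in at_top. u \<lceil>x\<rceil> * x\<^sup>2 < b"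
      using eventually_gt_at_top[of s] eventually_ge_at_top[of "real_of_int N"]
    proof eventually_elim
      case (elim x)
      have "\<lceil>x\<rceil> \<ge> N" using elim(3) by linarith
      with sN have "u \<lceil>x\<rceil> \<le> c / (real_of_int \<lceil>x\<rceil> - s)\<^sup>2" by blast
      also have "\<dots> \<le> c / (x - s)\<^sup>2"
        using elim(2) c(3) by (intro divide_left_mono power_mono mult_pos_pos) (auto, linarith+)
      finally have "u \<lceil>x\<rceil> * x\<^sup>2 \<le> c / (x - s)\<^sup>2 * x\<^sup>2" by (rule mult_right_mono) simp
      with elim(1) show ?case by simp
    qed
  next
    fix b assume b: "b < c0"
    \<comment> \<open>The maximum with 0 keeps \<open>c\<close> positive when \<open>b\<close> is
      negative.\<close>
    define c where "c = (c0 + max b 0) / 2"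
    have c: "c < c0" "b < c" "c > 0" using b c0 by (auto simp: c_def max_def)
    obtain s where s: "s > 0" "\<forall>x>0. c / (real_of_int x + s)\<^sup>2 \<le> u x"
      using solution_lower[of c] c by (auto simp: c0_def)
    \<comment> \<open>The extra 1 absorbs the rounding \<lceil>x\<rceil> \<le> x + 1.\<close>
    have "((\<lambda>x. c * x\<^sup>2 / (x + 1 + s)\<^sup>2) \<longlongrightarrow> c) at_top" using c by real_asymp
    then have "\<forall>\<^sub>F x in at_top. c * x\<^sup>2 / (x + 1 + s)\<^sup>2 > b" using c(2) by (rule order_tendstoD)
    then show "\<forall>\<^sub>F x in at_top. u \<lceil>x\<rceil> * x\<^sup>2 > b"
      using eventually_gt_at_top[of 0]
    proof eventually_elim
      case (elim x)
      have "c / (x + 1 + s)\<^sup>2 \<le> c / (real_of_int \<lceil>x\<rceil> + s)\<^sup>2"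
        using elim(2) c(3) s(1) of_int_ceiling_le_add_one[of x] le_of_int_ceiling[of x]
        by (intro divide_left_mono power_mono mult_pos_pos zero_less_power) linarith+
      also have "\<dots> \<le> u \<lceil>x\<rceil>" using s(2) elim(2) by simp
      finally have "c / (x + 1 + s)\<^sup>2 * x\<^sup>2 \<le> u \<lceil>x\<rceil> * x\<^sup>2" by (rule mult_right_mono) simp
      with elim(1) show ?case by simp
    qed
  qed
  then have "((\<lambda>x::real. u \<lceil>x\<rceil> * x\<^sup>2 / c0) \<longlongrightarrow> c0 / c0) at_top"
    using c0 by (intro tendsto_divide tendsto_const) auto
  then have "((\<lambda>x. u \<lceil>x\<rceil> / (6 * \<eta>\<^sup>2 / (\<sigma>\<^sup>2 * x\<^sup>2))) \<longlongrightarrow> 1) at_top"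
    using a_var(2) p_var(2) by (simp add: c0_def field_simps)
  then show ?thesis by (rule asymp_equivI')
qed

end
end

theorem theorem1:
  fixes W :: "'w measure"
    and a :: "int pmf" and p :: "nat pmf"
    and xi :: "nat list \<Rightarrow> 'w \<Rightarrow> int" and nu :: "nat list \<Rightarrow> 'w \<Rightarrow> nat"
    and r \<eta> \<sigma> :: real
  assumes brw: "branching_random_walk W a p xi nu"
    and a_moment: "r > 4" "integrable (measure_pmf a) (\<lambda>k. \<bar>real_of_int k\<bar> powr r)"
    and a_mean: "measure_pmf.expectation a real_of_int = 0"
    and a_var: "measure_pmf.variance a real_of_int = \<eta>\<^sup>2" "\<eta>\<^sup>2 > 0"
    and p_moment: "integrable (measure_pmf p) (\<lambda>k. real k ^ 3)"
    and p_mean: "measure_pmf.expectation p real = 1"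
    and p_var: "measure_pmf.variance p real = \<sigma>\<^sup>2" "\<sigma>\<^sup>2 > 0"
  shows "(\<lambda>x::real. measure W {\<omega> \<in> space W.
            maximal_displacement (\<lambda>u. xi u \<omega>) (\<lambda>u. nu u \<omega>) \<ge> ereal x})
         \<sim>[at_top] (\<lambda>x. 6 * \<eta>\<^sup>2 / (\<sigma>\<^sup>2 * x\<^sup>2))"
proof -
  interpret branching_random_walk W a p xi nu by (rule brw)
  interpret critical_walk a p r \<eta> \<sigma> by unfold_locales fact+
  have "measure W {\<omega> \<in> space W. maximal_displacement (\<lambda>u. xi u \<omega>) (\<lambda>u. nu u \<omega>) \<ge> ereal x}
      = reach_prob a p \<lceil>x\<rceil>" for x
    using prob_reaches_inj[of id "\<lceil>x\<rceil>"] by (simp add: maximal_displacement_ge_iff)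
  then show ?thesis
    using solution_asymptotics[OF reach_prob_range reach_prob_antimono reach_prob_nonpos reach_prob_recursion] by simp
qed

end
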